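(* Let $B\wr\mathcal{H}(d)$, $\chi=(\chi(S),\chi(R))$, $\widetilde{\mathcal{H}}=\widetilde{\mathcal{H}}^\chi_d$ and $(M,\sigma^M,\rho^M)$ be as in the context; in particular $S$ and $R$ act on $M\otimes M$ as multiplication by the scalars $\chi(S),\chi(R)\in K$. Then $(M,\sigma^M,\rho^M)$ is a ground module if and only if the following hold: (i) for all $1\le i\le d-1$, all $b\in B^{\otimes d}$ and all $m\in M^{\otimes d}$: (M2) $\sigma^M_i(b\cdot m)=\sigma_i(b)\cdot\sigma^M_i(m)$ and $\rho^M_i(b\cdot m)=\sigma_i(b)\cdot\rho^M_i(m)+\rho_i(b)\cdot m$; (M4) $\chi(S)(\sigma^M_i)^2+\rho^M_i\sigma^M_i+\sigma^M_i\rho^M_i=l^M_{S_i}\sigma^M_i$ and $\chi(R)(\sigma^M_i)^2+(\rho^M_i)^2=l^M_{S_i}\rho^M_i+l^M_{R_i}$; (ii) if $d\ge 3$, additionally for all $i,j$ with $|i-j|=1$: (M5) $\sigma^M_i\sigma^M_j\sigma^M_i=\sigma^M_j\sigma^M_i\sigma^M_j$ and $\rho^M_i\sigma^M_j\sigma^M_i=\sigma^M_j\sigma^M_i\rho^M_j$; (M6) $\rho^M_i\sigma^M_j\rho^M_i=\chi(S)\,\sigma^M_j\rho^M_i\sigma^M_j+\rho^M_j\rho^M_i\sigma^M_j+\sigma^M_j\rho^M_i\rho^M_j$; (M7) $\rho^M_i\rho^M_j\rho^M_i+\chi(R)\,\sigma^M_i\rho^M_j\sigma^M_i=\rho^M_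j\rho^M_i\rho^M_j+\chi(R)\,\sigma^M_j\rho^M_i\sigma^M_j$.
   Context: Let $K$ be a commutative ring and $B$ a unital associative $K$-algebra, free as a $K$-module; all tensor products are over $K$. Fix $d\ge 2$, elements $S,R\in B\otimes B$ and $K$-linear maps $\sigma,\rho:B\otimes B\to B\otimes B$. For $Z\in B\otimes B$ and $1\le i\le d-1$ put $Z_i:=1^{\otimes(i-1)}\otimes Z\otimes 1^{\otimes(d-i-1)}\in B^{\otimes d}$; for $\phi\in\mathrm{End}_K(B\otimes B)$ let $\phi_i\in\mathrm{End}_K(B^{\otimes d})$ be $\phi$ applied to tensor factors $i,i+1$. The quantum wreath product $B\wr\mathcal{H}(d)$ is the unital $K$-algebra generated by the algebra $B^{\otimes d}$ and elements $H_1,\dots,H_{d-1}$ subject to $H_kH_{k+1}H_k=H_{k+1}H_kH_{k+1}$, $H_iH_j=H_jH_i$ for $|i-j|\ge2$, $H_i^2=S_iH_i+R_i$, and $H_ib=\sigma_i(b)H_i+\rho_i(b)$ for $b\in B^{\otimes d}$. For $w\in\Sigma_d$ with reduced expression $s_{i_1}\cdots s_{i_N}$ ($s_i=(i,i+1)$) put $H_w:=H_{i_1}\cdots H_{i_N}$. Standing assumption: $B\wr\mathcal{H}(d)$ has a PBW basis: for a $K$-basis $\{b_j\}$ of $B$, the elements $(b_{j_1}\otimes\cdots\otimes b_{j_d})H_w$, $w\in\Sigma_d$, form a $K$-basis; so each element is uniquely $\sum_w b_wH_w$ with $b_w\in B^{\otimes d}$. Fix $\chi(S),\chi(R)\in K$.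 The twisted Hecke algebra $\widetilde{\mathcal{H}}=\widetilde{\mathcal{H}}^\chi_d$ is the $K$-algebra generated by $h_1,\dots,h_{d-1}$ subject to the type A braid relations and $h_i^2=\chi(S)h_i+\chi(R)$; it has $K$-basis $\{h_w\}_{w\in\Sigma_d}$. Let $M$ be a left $B$-module such that $S$ and $R$ act on the $B\otimes B$-module $M\otimes M$ as multiplication by $\chi(S)$ and $\chi(R)$, and fix $\sigma^M,\rho^M\in\mathrm{End}_K(M\otimes M)$. Let $\sigma^M_i,\rho^M_i\in\mathrm{End}_K(M^{\otimes d})$ be these maps on tensor factors $i,i+1$; for $X\in B^{\otimes d}$, $l^M_X\in\mathrm{End}_K(M^{\otimes d})$ is the (factorwise) action of $X$. Let $K\Sigma_d$ denote the free $K$-module with basis $\Sigma_d$. A choice map $r$ assigns to each $w\in\Sigma_d$ a reduced expression $r(w)$, with $r(1)$ empty, such that for $w\ne1$, $r(w)=s_ir(x)$ for some $i$ with $x=s_iw$, $\ell(x)=\ell(w)-1$. The structure map $\tau^M=\tau^M(r):K\Sigma_d\otimes M^{\otimes d}\to M^{\otimes d}\otimes\widetilde{\mathcal{H}}$ is defined recursively by $\tau^M(1\otimes m)=m\otimes1$, $\tau^M(s_i\otimes m)=\sigma^M_i(m)\otimes h_i+\rho^M_i(m)\otimes1$, and, if $r(w)=s_ir(x)$ and $\tau^M(x\otimes m)=\sum_y m_y\otimes h_y$, then $\tau^M(w\otimes m)=\sum_y\big(\sigma^M_i(m_y)\otimes h_ih_y+\rho^M_i(m_y)\otimes h_y\big)$.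 The triple $(M,\sigma^M,\rho^M)$ (with twist $\chi$) is a ground module if (i) $\tau^M(r)$ is independent of the choice map $r$, and (ii) for all $w,x\in\Sigma_d$, $b\in B^{\otimes d}$, $m\in M^{\otimes d}$: writing $H_wb=\sum_g b_gH_g$ ($b_g\in B^{\otimes d}$) one has $\tau^M(w\otimes b\cdot m)=\sum_g(b_g\otimes1)\cdot\tau^M(g\otimes m)$; and writing $H_wH_x=\sum_g c_gH_g$ ($c_g\in B^{\otimes d}$) and $\tau^M(x\otimes m)=\sum_y m_y\otimes h_y$, one has $\sum_g(c_g\otimes1)\cdot\tau^M(g\otimes m)=\sum_y\tau^M(w\otimes m_y)(1\otimes h_y)$. Here $B^{\otimes d}$ acts on $M^{\otimes d}\otimes\widetilde{\mathcal{H}}$ via the first factor and $(1\otimes h)$ denotes right multiplication on the $\widetilde{\mathcal{H}}$ factor. *)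

theory Defs
  imports "HOL.Modules" "HOL-Library.Poly_Mapping" "HOL-Combinatorics.Permutations" "HOL-Combinatorics.Transposition"
begin

text \<open>A K-module is a type 'm with a scalar action sc :: 'k => 'm => 'm.
 The free K-module on words 'm list is ('m list =>0 'k); the n-th tensor power
 of the module is the degree-n part (all keys of length n) modulo the K-submodule
 trel sc generated by the multilinearity relations.  Elements of the tensor power are
 represented by representatives; equality in the tensor power is teq sc.\<close>

definition pscale :: "'k::comm_ring_1 \<Rightarrow> ('a \<Rightarrow>\<^sub>0 'k) \<Rightarrow> ('a \<Rightarrow>\<^sub>0 'k)" where
  "pscale c v = Poly_Mapping.map (\<lambda>x. c * x) v"

definition pure :: "'a \<Rightarrow> ('a \<Rightarrow>\<^sub>0 'k::comm_ring_1)" where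
  "pure l = Poly_Mapping.single l 1"

definition plin :: "('a \<Rightarrow> ('b \<Rightarrow>\<^sub>0 'k::comm_ring_1)) \<Rightarrow> ('a \<Rightarrow>\<^sub>0 'k) \<Rightarrow> ('b \<Rightarrow>\<^sub>0 'k)" where
  "plin g v = (\<Sum>a\<in>Poly_Mapping.keys v. pscale (Poly_Mapping.lookup v a) (g a))"

inductive_set trel :: "('k::comm_ring_1 \<Rightarrow> 'm::ab_group_add \<Rightarrow> 'm) \<Rightarrow> ('m list \<Rightarrow>\<^sub>0 'k) set"
  for sc :: "'k::comm_ring_1 \<Rightarrow> 'm::ab_group_add \<Rightarrow> 'm" where
  rel_add: "i < length l \<Longrightarrow>
     pure (l[i := x + y]) - pure (l[i := x]) - pure (l[i := y]) \<in> trel sc"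
| rel_smul: "i < length l \<Longrightarrow> pure (l[i := sc c x]) - pscale c (pure (l[i := x])) \<in> trel sc"
| rel_zero: "0 \<in> trel sc"
| rel_plus: "u \<in> trel sc \<Longrightarrow> v \<in> trel sc \<Longrightarrow> u + v \<in> trel sc"
| rel_scale: "u \<in> trel sc \<Longrightarrow> pscale c u \<in> trel sc"

definition teq :: "('k::comm_ring_1 \<Rightarrow> 'm::ab_group_add \<Rightarrow> 'm) \<Rightarrow> ('m list \<Rightarrow>\<^sub>0 'k) \<Rightarrow> ('m list \<Rightarrow>\<^sub>0 'k) \<Rightarrow> bool" where
  "teq sc v w \<longleftrightarrow> v - w \<in> trel sc"

definition tsupp :: "nat \<Rightarrow> ('m list \<Rightarrow>\<^sub>0 'k::zero) \<Rightarrow> bool" where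
  "tsupp n v \<longleftrightarrow> (\<forall>l\<in>Poly_Mapping.keys v. length l = n)"

definition tlin :: "('k::comm_ring_1 \<Rightarrow> 'm::ab_group_add \<Rightarrow> 'm) \<Rightarrow> nat
    \<Rightarrow> (('m list \<Rightarrow>\<^sub>0 'k) \<Rightarrow> ('m list \<Rightarrow>\<^sub>0 'k)) \<Rightarrow> bool" where
  "tlin sc n f \<longleftrightarrow>
     (\<forall>v. tsupp n v \<longrightarrow> tsupp n (f v)) \<and>
     (\<forall>v w. tsupp n v \<longrightarrow> tsupp n w \<longrightarrow> teq sc v w \<longrightarrow> teq sc (f v) (f w)) \<and>
     (\<forall>v w. tsupp n v \<longrightarrow> tsupp n w \<longrightarrow> teq sc (f (v + w)) (f v + f w)) \<and>
     (\<forall>c v. tsupp n v \<longrightarrow> teq sc (f (pscale c v)) (pscale c (f v)))"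

text \<open>phi_i: a map on the second tensor power applied to tensor factors i, i+1 (1-based)\<close>
definition slot :: "nat \<Rightarrow> (('m list \<Rightarrow>\<^sub>0 'k) \<Rightarrow> ('m list \<Rightarrow>\<^sub>0 'k))
    \<Rightarrow> ('m list \<Rightarrow>\<^sub>0 'k::comm_ring_1) \<Rightarrow> ('m list \<Rightarrow>\<^sub>0 'k)" where
  "slot i f = plin (\<lambda>l. plin (\<lambda>p. pure (take (i - 1) l @ p @ drop (i + 1) l))
                              (f (pure [l ! (i - 1), l ! i])))"

definition emb :: "nat \<Rightarrow> nat \<Rightarrow> ('b::one list \<Rightarrow>\<^sub>0 'k::comm_ring_1) \<Rightarrow> ('b list \<Rightarrow>\<^sub>0 'k)" where
  "emb d i Z = plin (\<lambda>p. pure (replicate (i - 1) 1 @ p @ replicate (d - i - 1) 1)) Z"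

text \<open>factorwise action of X in B^(x)d on M^(x)d (for act = times: the product of B^(x)d)\<close>
definition tact :: "('b \<Rightarrow> 'm \<Rightarrow> 'm) \<Rightarrow> ('b list \<Rightarrow>\<^sub>0 'k::comm_ring_1)
    \<Rightarrow> ('m list \<Rightarrow>\<^sub>0 'k) \<Rightarrow> ('m list \<Rightarrow>\<^sub>0 'k)" where
  "tact act X v = plin (\<lambda>l. plin (\<lambda>l'. pure (map2 act l l')) v) X"

definition tone :: "nat \<Rightarrow> ('b::one list \<Rightarrow>\<^sub>0 'k::comm_ring_1)" where
  "tone d = pure (replicate d 1)"

definition Sym :: "nat \<Rightarrow> (nat \<Rightarrow> nat) set" where
  "Sym d = {p. p permutes {1..d}}"

definition sref :: "nat \<Rightarrow> nat \<Rightarrow> nat" where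
  "sref i = transpose i (Suc i)"

definition word_perm :: "nat list \<Rightarrow> nat \<Rightarrow> nat" where
  "word_perm ws = foldr (\<lambda>i p. sref i \<circ> p) ws id"

definition perm_len :: "nat \<Rightarrow> (nat \<Rightarrow> nat) \<Rightarrow> nat" where
  "perm_len d w = card {(i, j). 1 \<le> i \<and> i < j \<and> j \<le> d \<and> w j < w i}"

definition reduced_expr :: "nat \<Rightarrow> nat list \<Rightarrow> (nat \<Rightarrow> nat) \<Rightarrow> bool" where
  "reduced_expr d ws w \<longleftrightarrow> set ws \<subseteq> {1..<d} \<and> word_perm ws = w \<and> length ws = perm_len d w"

definition rexp :: "nat \<Rightarrow> (nat \<Rightarrow> nat) \<Rightarrow> nat list" where
  "rexp d w = (SOME ws. reduced_expr d ws w)"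

definition choice_map :: "nat \<Rightarrow> ((nat \<Rightarrow> nat) \<Rightarrow> nat list) \<Rightarrow> bool" where
  "choice_map d r \<longleftrightarrow>
     (\<forall>w\<in>Sym d. reduced_expr d (r w) w) \<and> r id = [] \<and>
     (\<forall>w\<in>Sym d. w \<noteq> id \<longrightarrow>
        (\<exists>i. r w = i # r (sref i \<circ> w) \<and> perm_len d (sref i \<circ> w) = perm_len d w - 1))"

definition gen_prod :: "(nat \<Rightarrow> 'a::monoid_mult) \<Rightarrow> nat list \<Rightarrow> 'a" where
  "gen_prod g ws = foldr (\<lambda>i a. g i * a) ws 1"

text \<open>H_w resp. h_w (well defined by the braid relations)\<close>
definition gw :: "nat \<Rightarrow> (nat \<Rightarrow> 'a::monoid_mult) \<Rightarrow> (nat \<Rightarrow> nat) \<Rightarrow> 'a" where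
  "gw d g w = gen_prod g (rexp d w)"

definition hcoord :: "('k \<Rightarrow> 'h \<Rightarrow> 'h) \<Rightarrow> (nat \<Rightarrow> 'h::{monoid_mult,comm_monoid_add}) \<Rightarrow> nat
    \<Rightarrow> 'h \<Rightarrow> (nat \<Rightarrow> nat) \<Rightarrow> 'k" where
  "hcoord sH h d x = (SOME c. x = (\<Sum>w\<in>Sym d. sH (c w) (gw d h w)))"

text \<open>elements of M^(x)d (x) H~ are represented as functions z |-> m_z (coefficient of h_z)\<close>
type_synonym ('m, 'k) mh = "(nat \<Rightarrow> nat) \<Rightarrow> ('m list \<Rightarrow>\<^sub>0 'k)"

definition heq :: "('k::comm_ring_1 \<Rightarrow> 'm::ab_group_add \<Rightarrow> 'm) \<Rightarrow> nat \<Rightarrow> ('m,'k) mh \<Rightarrow> ('m,'k) mh \<Rightarrow> bool" where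
  "heq sc d T T' \<longleftrightarrow> (\<forall>z\<in>Sym d. teq sc (T z) (T' z))"

definition hright :: "('k::comm_ring_1 \<Rightarrow> 'h \<Rightarrow> 'h) \<Rightarrow> (nat \<Rightarrow> 'h::ring_1) \<Rightarrow> nat
    \<Rightarrow> ('m,'k) mh \<Rightarrow> 'h \<Rightarrow> ('m,'k) mh" where
  "hright sH h d T x = (\<lambda>z. \<Sum>u\<in>Sym d. pscale (hcoord sH h d (gw d h u * x) z) (T u))"

text \<open>tau^M evaluated along a word: tau_word ... (r w) m = tau^M(r)(w (x) m).
 sM, rM are sigma^M, rho^M on M (x) M.\<close>
fun tau_word :: "('k::comm_ring_1 \<Rightarrow> 'h::ring_1 \<Rightarrow> 'h) \<Rightarrow> (nat \<Rightarrow> 'h) \<Rightarrow> nat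
    \<Rightarrow> (('m list \<Rightarrow>\<^sub>0 'k) \<Rightarrow> ('m list \<Rightarrow>\<^sub>0 'k)) \<Rightarrow> (('m list \<Rightarrow>\<^sub>0 'k) \<Rightarrow> ('m list \<Rightarrow>\<^sub>0 'k))
    \<Rightarrow> nat list \<Rightarrow> ('m list \<Rightarrow>\<^sub>0 'k) \<Rightarrow> ('m,'k) mh" where
  "tau_word sH h d sM rM [] m = (\<lambda>z. if z = id then m else 0)"
| "tau_word sH h d sM rM (i # ws) m =
     (let T = tau_word sH h d sM rM ws m in
      (\<lambda>z. \<Sum>y\<in>Sym d. pscale (hcoord sH h d (h i * gw d h y) z) (slot i sM (T y))
                        + (if z = y then slot i rM (T y) else 0)))"

text \<open>act: the B-action on M; sB: K-structure of B (so K acts on M by c.m = (c 1_B).m);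
 H, iota: the quantum wreath product, given as a ring with the images H_i of the generators and
 the embedding iota of B^(x)d; sH, h: the twisted Hecke algebra with generators h_i.\<close>
definition ground_module ::
  "('b::ring_1 \<Rightarrow> 'm::ab_group_add \<Rightarrow> 'm) \<Rightarrow> ('k::comm_ring_1 \<Rightarrow> 'b \<Rightarrow> 'b)
   \<Rightarrow> (nat \<Rightarrow> 'a::ring_1) \<Rightarrow> (('b list \<Rightarrow>\<^sub>0 'k) \<Rightarrow> 'a)
   \<Rightarrow> ('k \<Rightarrow> 'h::ring_1 \<Rightarrow> 'h) \<Rightarrow> (nat \<Rightarrow> 'h) \<Rightarrow> nat
   \<Rightarrow> (('m list \<Rightarrow>\<^sub>0 'k) \<Rightarrow> ('m list \<Rightarrow>\<^sub>0 'k)) \<Rightarrow> (('m list \<Rightarrow>\<^sub>0 'k) \<Rightarrow> ('m list \<Rightarrow>\<^sub>0 'k)) \<Rightarrow> bool" where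
  "ground_module act sB H iota sH h d sM rM \<longleftrightarrow>
    (let scM = (\<lambda>c m. act (sB c 1) m);
         tau = (\<lambda>r w m. tau_word sH h d sM rM (r w) m) in
     (\<forall>r r'. choice_map d r \<longrightarrow> choice_map d r' \<longrightarrow>
        (\<forall>w\<in>Sym d. \<forall>m. tsupp d m \<longrightarrow> heq scM d (tau r w m) (tau r' w m)))
   \<and> (\<forall>r. choice_map d r \<longrightarrow>
        (\<forall>w\<in>Sym d. \<forall>b m c. tsupp d b \<longrightarrow> tsupp d m \<longrightarrow> (\<forall>g\<in>Sym d. tsupp d (c g)) \<longrightarrow>
            gw d H w * iota b = (\<Sum>g\<in>Sym d. iota (c g) * gw d H g) \<longrightarrow>
            heq scM d (tau r w (tact act b m)) (\<lambda>z. \<Sum>g\<in>Sym d. tact act (c g) (tau r g m z)))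
      \<and> (\<forall>w\<in>Sym d. \<forall>x\<in>Sym d. \<forall>m c. tsupp d m \<longrightarrow> (\<forall>g\<in>Sym d. tsupp d (c g)) \<longrightarrow>
            gw d H w * gw d H x = (\<Sum>g\<in>Sym d. iota (c g) * gw d H g) \<longrightarrow>
            heq scM d (\<lambda>z. \<Sum>g\<in>Sym d. tact act (c g) (tau r g m z))
                      (\<lambda>z. \<Sum>y\<in>Sym d. hright sH h d (tau r w (tau r x m y)) (gw d h y) z))))"

end

theory Submission
  imports Defs "HOL-Library.Function_Algebras"
begin

text \<open>Let \<open>H\<^sub>i\<close> act on the tensor product of the d-th power of M with the twisted Hecke algebra by
  \<open>T\<^sub>i = \<sigma>\<^sub>i \<otimes> h\<^sub>i + \<rho>\<^sub>i \<otimes> 1\<close>; these operators commute with right multiplication by the Hecke algebra,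
  and the structure map along a word is the product of the \<open>T\<^sub>i\<close> applied to \<open>m \<otimes> 1\<close>.  Expanding in the
  basis \<open>h\<^sub>w\<close>, (M2) says that \<open>T\<^sub>i\<close> satisfies the commutation relation of \<open>H\<^sub>i\<close> with B, (M4) the quadratic
  relation, and (M5)-(M7) the braid relation; the distant commutation relation is automatic.
  If these hold, Matsumoto's theorem makes the product along a reduced word well defined, and left
  multiplication by \<open>H\<^sub>i\<close> on a PBW basis element corresponds to \<open>T\<^sub>i\<close>, whence the ground module axioms.
  Conversely, the axioms for products of simple reflections are these operator relations applied to
  \<open>m \<otimes> 1\<close>, and their coefficients are (M2)-(M7).\<close>

subsection \<open>Linear maps on free modules\<close>

text \<open>The wreath product is available through its relations and its PBW basis, not through a
  universal property, so relations between the operators do not by themselves give an action of the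
  algebra. The action has to be read off PBW coordinates, and its compatibility with products is
  recovered by left multiplication with one generator at a time. Equality in a tensor power is a
  congruence on representatives. Maps on tensor factors are extended linearly on words, so expanding
  products of operators is exact; the congruence enters with the relations themselves, together with
  the condition that all words have the right length. For adjacent i, j the product of three
  operators has six coefficients. Exchanging i and j only swaps the sides of the first equation of
  (M5) and of (M7), while the second equation of (M5) and (M6) each give two conditions: six in all.
  The scalars \<chi>(S), \<chi>(R) in (M4), (M6), (M7) come from every square of some
  \<open>h i\<close> produced by the expansion.\<close>

lemma lookup_pscale [simp]: "Poly_Mapping.lookup (pscale c v) a = c * Poly_Mapping.lookup v a"
  by (simp add: pscale_def map.rep_eq when_def)

lemma pscale_add_right: "pscale c (u + v) = pscale c u + pscale c v"
  by (rule poly_mapping_eqI) (simp add: lookup_add distrib_left)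

lemma pscale_add_left: "pscale (a + b) v = pscale a v + pscale b v"
  by (rule poly_mapping_eqI) (simp add: lookup_add distrib_right)

lemma pscale_pscale [simp]: "pscale a (pscale b v) = pscale (a * b) v"
  by (rule poly_mapping_eqI) (simp add: mult.assoc)

lemma pscale_zero_right [simp]: "pscale c 0 = 0"
  by (rule poly_mapping_eqI) simp

lemma pscale_zero_left [simp]: "pscale 0 v = 0"
  by (rule poly_mapping_eqI) simp

lemma pscale_one [simp]: "pscale 1 v = v"
  by (rule poly_mapping_eqI) simp

lemma pscale_uminus_one: "pscale (- 1) v = - v"
  by (rule poly_mapping_eqI) simp

lemma pscale_diff_right: "pscale c (u - v) = pscale c u - pscale c v"
  by (rule poly_mapping_eqI) (simp add: lookup_minus right_diff_distrib)

lemma pscale_sum_right: "pscale c (sum f A) = (\<Sum>a\<in>A. pscale c (f a))"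
  by (induction A rule: infinite_finite_induct) (simp_all add: pscale_add_right)

lemma pscale_sum_left: "pscale (sum f A) v = (\<Sum>a\<in>A. pscale (f a) v)"
  by (induction A rule: infinite_finite_induct) (simp_all add: pscale_add_left)

lemma poly_mapping_decomp: "v = (\<Sum>a\<in>Poly_Mapping.keys v. pscale (Poly_Mapping.lookup v a) (pure a))"
proof (rule poly_mapping_eqI)
  fix k
  have "Poly_Mapping.lookup (\<Sum>a\<in>Poly_Mapping.keys v. pscale (Poly_Mapping.lookup v a) (pure a)) k
     = (\<Sum>a\<in>Poly_Mapping.keys v. if a = k then Poly_Mapping.lookup v k else 0)"
    unfolding lookup_sum by (rule sum.cong) (auto simp: pure_def lookup_single)
  also have "\<dots> = Poly_Mapping.lookup v k"
    by (simp add: in_keys_iff)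
  finally show "Poly_Mapping.lookup v k
    = Poly_Mapping.lookup (\<Sum>a\<in>Poly_Mapping.keys v. pscale (Poly_Mapping.lookup v a) (pure a)) k" ..
qed

text \<open>Linearity on representatives, in contrast to \<open>tlin\<close>, which asks for it
  modulo the tensor relations and in one degree only. Every \<open>plin\<close> extension has it,
  hence so do \<open>slot i f\<close> for arbitrary \<open>f\<close> and
  \<open>tact act X\<close>.\<close>

definition plinear :: "(('a \<Rightarrow>\<^sub>0 'k::comm_ring_1) \<Rightarrow> ('b \<Rightarrow>\<^sub>0 'k)) \<Rightarrow> bool" where
  "plinear F \<longleftrightarrow> (\<forall>u v. F (u + v) = F u + F v) \<and> (\<forall>c v. F (pscale c v) = pscale c (F v))"

lemma plinearI:
  "(\<And>u v. F (u + v) = F u + F v) \<Longrightarrow> (\<And>c v. F (pscale c v) = pscale c (F v)) \<Longrightarrow> plinear F"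
  by (simp add: plinear_def)

lemma plinear_add: "plinear F \<Longrightarrow> F (u + v) = F u + F v"
  and plinear_pscale: "plinear F \<Longrightarrow> F (pscale c v) = pscale c (F v)"
  by (simp_all add: plinear_def)

lemma plinear_zero: "plinear F \<Longrightarrow> F 0 = 0"
  using plinear_pscale[of F 0 0] by simp

lemma plinear_diff: "plinear F \<Longrightarrow> F (u - v) = F u - F v"
  using plinear_add[of F "u - v" v] by (simp add: algebra_simps)

lemma plinear_sum: "plinear F \<Longrightarrow> F (sum f A) = (\<Sum>a\<in>A. F (f a))"
  by (induction A rule: infinite_finite_induct) (simp_all add: plinear_add plinear_zero)

lemma plinear_decomp:
  "plinear F \<Longrightarrow> F v = (\<Sum>a\<in>Poly_Mapping.keys v. pscale (Poly_Mapping.lookup v a) (F (pure a)))"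
  by (subst poly_mapping_decomp[of v]) (simp add: plinear_sum plinear_pscale)

lemma plinear_eqI:
  assumes "plinear F" "plinear G" "\<And>a. a \<in> Poly_Mapping.keys v \<Longrightarrow> F (pure a) = G (pure a)"
  shows "F v = G v"
  unfolding plinear_decomp[OF assms(1), of v] plinear_decomp[OF assms(2), of v]
  using assms(3) by simp

lemma plinear_comp: "plinear F \<Longrightarrow> plinear G \<Longrightarrow> plinear (\<lambda>v. F (G v))"
  by (simp add: plinear_def)

lemma plinear_plus: "plinear F \<Longrightarrow> plinear G \<Longrightarrow> plinear (\<lambda>v. F v + G v)"
  and plinear_minus: "plinear F \<Longrightarrow> plinear G \<Longrightarrow> plinear (\<lambda>v. F v - G v)"
  and plinear_scaled: "plinear F \<Longrightarrow> plinear (\<lambda>v. pscale c (F v))"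
  by (simp_all add: plinear_def pscale_add_right pscale_diff_right mult.commute)

lemma plinear_id: "plinear (\<lambda>v. v)"
  by (simp add: plinear_def)

lemma plin_superset:
  assumes "finite A" "Poly_Mapping.keys v \<subseteq> A"
  shows "plin g v = (\<Sum>a\<in>A. pscale (Poly_Mapping.lookup v a) (g a))"
  unfolding plin_def using assms by (intro sum.mono_neutral_left) (auto simp: in_keys_iff)

lemma plinear_plin:
  fixes g :: "'a \<Rightarrow> ('b \<Rightarrow>\<^sub>0 'k::comm_ring_1)"
  shows "plinear (plin g)"
proof (rule plinearI)
  fix u v :: "'a \<Rightarrow>\<^sub>0 'k"
  let ?A = "Poly_Mapping.keys u \<union> Poly_Mapping.keys v"
  show "plin g (u + v) = plin g u + plin g v"
    using keys_add[of u v]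
    by (simp add: plin_superset[of ?A] lookup_add pscale_add_left sum.distrib)
next
  fix c and v :: "'a \<Rightarrow>\<^sub>0 'k"
  have "Poly_Mapping.keys (pscale c v) \<subseteq> Poly_Mapping.keys v"
    by (auto simp: in_keys_iff)
  then show "plin g (pscale c v) = pscale c (plin g v)"
    by (simp add: plin_superset[of "Poly_Mapping.keys v"] pscale_sum_right)
qed

lemma plin_pure [simp]: "plin g (pure a) = g a"
  by (simp add: plin_def pure_def)

lemma keys_pure [simp]: "Poly_Mapping.keys (pure a :: _ \<Rightarrow>\<^sub>0 'k::comm_ring_1) = {a}"
  by (simp add: pure_def)

lemma plin_cong: "(\<And>a. a \<in> Poly_Mapping.keys v \<Longrightarrow> f a = g a) \<Longrightarrow> plin f v = plin g v"
  by (simp add: plin_def)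

lemma plinear_plin_plin: "plinear F \<Longrightarrow> F (plin g v) = plin (\<lambda>a. F (g a)) v"
  by (simp add: plin_def plinear_sum plinear_pscale)

lemma plin_swap: "plin (\<lambda>a. plin (\<lambda>b. f a b) v) u = plin (\<lambda>b. plin (\<lambda>a. f a b) u) v"
  by (simp add: plin_def pscale_sum_right sum.swap[of _ "Poly_Mapping.keys v"] mult.commute)

subsection \<open>Tensor powers\<close>

lemma trel_uminus: "u \<in> trel sc \<Longrightarrow> - u \<in> trel sc"
  using rel_scale[of u sc "- 1"] by (simp add: pscale_uminus_one)

lemma trel_sum: "(\<And>a. a \<in> A \<Longrightarrow> f a \<in> trel sc) \<Longrightarrow> sum f A \<in> trel sc"
  by (induction A rule: infinite_finite_induct) (auto intro: rel_zero rel_plus)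

lemma plinear_in_trelI:
  "plinear F \<Longrightarrow> (\<And>a. a \<in> Poly_Mapping.keys v \<Longrightarrow> F (pure a) \<in> trel sc) \<Longrightarrow> F v \<in> trel sc"
  by (subst plinear_decomp) (auto intro!: trel_sum rel_scale)

lemma teq_refl [simp]: "teq sc u u"
  by (simp add: teq_def rel_zero)

lemma teq_sym: "teq sc u v \<Longrightarrow> teq sc v u"
  using trel_uminus[of "u - v"] by (simp add: teq_def)

lemma teq_trans [trans]: "teq sc u v \<Longrightarrow> teq sc v w \<Longrightarrow> teq sc u w"
  using rel_plus[of "u - v" sc "v - w"] by (simp add: teq_def)

lemma teq_add: "teq sc u u' \<Longrightarrow> teq sc v v' \<Longrightarrow> teq sc (u + v) (u' + v')"
  using rel_plus[of "u - u'" sc "v - v'"] by (simp add: teq_def algebra_simps)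

lemma teq_pscale: "teq sc u v \<Longrightarrow> teq sc (pscale c u) (pscale c v)"
  using rel_scale[of "u - v" sc c] by (simp add: teq_def pscale_diff_right)

lemma teq_sum: "(\<And>a. a \<in> A \<Longrightarrow> teq sc (f a) (g a)) \<Longrightarrow> teq sc (sum f A) (sum g A)"
  by (induction A rule: infinite_finite_induct) (auto intro: teq_add)

lemma tsupp_zero [simp]: "tsupp n 0"
  by (simp add: tsupp_def)

lemma tsupp_add: "tsupp n u \<Longrightarrow> tsupp n v \<Longrightarrow> tsupp n (u + v)"
  using keys_add[of u v] by (auto simp: tsupp_def)

lemma tsupp_pscale: "tsupp n v \<Longrightarrow> tsupp n (pscale c v)"
  by (auto simp: tsupp_def in_keys_iff)

lemma tsupp_sum: "(\<And>a. a \<in> A \<Longrightarrow> tsupp n (f a)) \<Longrightarrow> tsupp n (sum f A)"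
  by (induction A rule: infinite_finite_induct) (auto intro: tsupp_add)

lemma tsupp_pure [simp]: "tsupp n (pure l :: 'm list \<Rightarrow>\<^sub>0 'k::comm_ring_1) \<longleftrightarrow> length l = n"
  by (simp add: tsupp_def)

lemma tsupp_plin: "(\<And>a. a \<in> Poly_Mapping.keys v \<Longrightarrow> tsupp n (g a)) \<Longrightarrow> tsupp n (plin g v)"
  by (auto simp: plin_def intro!: tsupp_sum tsupp_pscale)

text \<open>The relation submodule mixes all degrees, so a map defined only in degree n is first cut
  off outside degree n.\<close>
lemma plin_trel:
  assumes u: "u \<in> trel sc" "tsupp n u"
    and add: "\<And>l i x y. length l = n \<Longrightarrow> i < n \<Longrightarrow> g (l[i := x + y]) - g (l[i := x]) - g (l[i := y]) \<in> trel sc'"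
    and smul: "\<And>l i c x. length l = n \<Longrightarrow> i < n \<Longrightarrow> g (l[i := sc c x]) - pscale c (g (l[i := x])) \<in> trel sc'"
  shows "plin g u \<in> trel sc'"
proof -
  let ?g = "\<lambda>l. if length l = n then g l else 0"
  note L = plinear_plin[of ?g]
  have "plin ?g u \<in> trel sc'"
    using u(1)
  proof induction
    case (rel_add i l x y)
    then show ?case by (auto simp: plinear_diff[OF L] add intro: trel.rel_zero)
  next
    case (rel_smul i l c x)
    then show ?case by (auto simp: plinear_diff[OF L] plinear_pscale[OF L] smul intro: trel.rel_zero)
  qed (auto simp: plinear_zero[OF L] plinear_add[OF L] plinear_pscale[OF L] intro: trel.intros)
  moreover have "plin ?g u = plin g u"
    using u(2) by (intro plin_cong) (auto simp: tsupp_def)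
  ultimately show ?thesis by simp
qed

text \<open>Padding by fixed words moves a relation in letter \<open>i\<close> to the same relation
  in letter \<open>length A + i\<close>. This works in every degree at once, so plain induction over
  \<open>trel\<close> suffices.\<close>

lemma plin_insert_trel:
  assumes "u \<in> trel sc"
  shows "plin (\<lambda>p. pure (A @ p @ B)) u \<in> trel sc"
  using assms
proof induction
  note L = plinear_plin[of "\<lambda>p. pure (A @ p @ B)"]
  {
    case (rel_add i l x y)
    then show ?case
      using trel.rel_add[of "length A + i" "A @ l @ B" x y sc]
      by (simp add: plinear_diff[OF L] list_update_append)
  next
    case (rel_smul i l c x)
    then show ?case
      using trel.rel_smul[of "length A + i" "A @ l @ B" sc c x]
      by (simp add: plinear_diff[OF L] plinear_pscale[OF L] list_update_append)
  }
qed (auto simp: plinear_zero[OF plinear_plin] plinear_add[OF plinear_plin]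
      plinear_pscale[OF plinear_plin] intro: trel.intros)

lemma plinear_slot: "plinear (slot i f)"
  unfolding slot_def by (rule plinear_plin)

lemma tsupp_slot:
  assumes f: "tlin sc 2 f" and i: "1 \<le> i" "i < n" and v: "tsupp n v"
  shows "tsupp n (slot i f v)"
  unfolding slot_def
proof (intro tsupp_plin)
  fix l p assume l: "l \<in> Poly_Mapping.keys v" and p: "p \<in> Poly_Mapping.keys (f (pure [l ! (i - 1), l ! i]))"
  have "tsupp 2 (f (pure [l ! (i - 1), l ! i]))" using f by (simp add: tlin_def)
  then show "tsupp n (pure (take (i - 1) l @ p @ drop (i + 1) l))"
    using l p v i by (auto simp: tsupp_def)
qed

text \<open>Well-definedness of \<open>slot\<close> on the tensor power. A relation in one of the
  two letters of the slot is passed to \<open>f\<close> and handled by its linearity; a relation in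
  any other letter leaves the argument of \<open>f\<close> unchanged and survives in the surrounding
  word.\<close>

lemma slot_trel:
  fixes sc :: "'k::comm_ring_1 \<Rightarrow> 'm::ab_group_add \<Rightarrow> 'm"
  assumes f: "tlin sc 2 f" and i: "1 \<le> i" "i < n" and u: "u \<in> trel sc" "tsupp n u"
  shows "slot i f u \<in> trel sc"
proof -
  define I where "I = (\<lambda>(l :: 'm list). plin (\<lambda>p. pure (take (i - 1) l @ p @ drop (i + 1) l) :: 'm list \<Rightarrow>\<^sub>0 'k))"
  let ?g = "\<lambda>l. I l (f (pure [l ! (i - 1), l ! i]))"
  have Itr: "I l v \<in> trel sc" if "v \<in> trel sc" for l v
    using that unfolding I_def by (rule plin_insert_trel)
  have IL: "plinear (I l)" for l unfolding I_def by (rule plinear_plin)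
  have f2: "length p = 2" if "p \<in> Poly_Mapping.keys (f (pure [a, b]))" for p a b
  proof -
    have "tsupp 2 (f (pure [a, b]))" using f by (simp add: tlin_def)
    with that show ?thesis by (simp add: tsupp_def)
  qed
  \<comment> \<open>\<open>f\<close> is additive only modulo relations and only in degree two, so a
    three-term relation has to be carried through \<open>f\<close> in two moves.\<close>
  have fadd: "f v - f w - f w' \<in> trel sc" if "tsupp 2 v" "tsupp 2 w" "tsupp 2 w'" "v - w - w' \<in> trel sc" for v w w'
  proof -
    have 1: "f v - f (w + w') \<in> trel sc"
      using that f unfolding tlin_def teq_def by (metis diff_diff_eq tsupp_add)
    have 2: "f (w + w') - (f w + f w') \<in> trel sc"
      using that f unfolding tlin_def teq_def by blast
    show ?thesis using rel_plus[OF 1 2] by (simp add: algebra_simps)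
  qed
  have fsm: "f v - pscale c (f w) \<in> trel sc" if "tsupp 2 v" "tsupp 2 w" "v - pscale c w \<in> trel sc" for v w c
  proof -
    have 1: "f v - f (pscale c w) \<in> trel sc"
      using that f unfolding tlin_def teq_def by (metis tsupp_pscale)
    have 2: "f (pscale c w) - pscale c (f w) \<in> trel sc"
      using that f unfolding tlin_def teq_def by blast
    show ?thesis using rel_plus[OF 1 2] by simp
  qed
  have Iadd: "I (l[j := x + y]) v - I (l[j := x]) v - I (l[j := y]) v \<in> trel sc"
    and Ismul: "I (l[j := sc c x]) v - pscale c (I (l[j := x]) v) \<in> trel sc"
    if l: "length l = n" and j: "j < n" "j \<noteq> i - 1" "j \<noteq> i" and v: "tsupp 2 v" for l j x y v c
  proof -
    \<comment> \<open>The word put into the slot has length two, like the one it replaces, so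
      letters to the right of the slot keep their positions.\<close>
    have upd: "take (i - 1) (l[j := x]) @ p @ drop (i + 1) (l[j := x])
             = (take (i - 1) l @ p @ drop (i + 1) l)[j := x]" if "length p = 2" for x p
    proof (cases "j < i - 1")
      case True
      then show ?thesis using l i by (simp add: list_update_append take_update_swap)
    next
      case False
      then have "j \<ge> i + 1" using j by linarith
      then show ?thesis using l i that
        by (simp add: list_update_append drop_update_swap Suc_diff_le diff_diff_eq numeral_2_eq_2)
    qed
    have v2: "length p = 2" if "p \<in> Poly_Mapping.keys v" for p
      using v that by (simp add: tsupp_def)
    have L: "plinear (\<lambda>v. I (l[j := x + y]) v - I (l[j := x]) v - I (l[j := y]) v)"
      by (intro plinear_minus IL)
    have jl: "j < length (take (i - 1) l @ p @ drop (i + 1) l)" if "length p = 2" for p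
      using that l i j by auto
    have Ipure: "I (l[j := x]) (pure p) = pure ((take (i - 1) l @ p @ drop (i + 1) l)[j := x])"
      if "p \<in> Poly_Mapping.keys v" for x p
      unfolding I_def plin_pure upd[OF v2[OF that]] ..
    show "I (l[j := x + y]) v - I (l[j := x]) v - I (l[j := y]) v \<in> trel sc"
      by (rule plinear_in_trelI[OF L])
        (simp only: Ipure, intro rel_add jl v2)
    have L': "plinear (\<lambda>v. I (l[j := sc c x]) v - pscale c (I (l[j := x]) v))"
      by (intro plinear_minus IL plinear_scaled)
    show "I (l[j := sc c x]) v - pscale c (I (l[j := x]) v) \<in> trel sc"
      by (rule plinear_in_trelI[OF L'])
        (simp only: Ipure, intro rel_smul jl v2)
  qed
  have Iupd: "I (l[j := x]) = I l" if "j = i - 1 \<or> j = i" for l j x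
    using that i by (auto simp: I_def)
  have r2: "pure [x + y, z] - pure [x, z] - pure [y, z] \<in> trel sc"
    "pure [z, x + y] - pure [z, x] - pure [z, y] \<in> trel sc"
    "pure [sc c x, z] - pscale c (pure [x, z]) \<in> trel sc"
    "pure [z, sc c x] - pscale c (pure [z, x]) \<in> trel sc" for x y z c
    using rel_add[of 0 "[x, z]" x y sc] rel_add[of 1 "[z, x]" x y sc]
      rel_smul[of 0 "[x, z]" sc c x] rel_smul[of 1 "[z, x]" sc c x] by simp_all
  have "plin ?g u \<in> trel sc"
  proof (rule plin_trel[OF u])
    fix l :: "'m list" and j x y
    assume l: "length l = n" and j: "j < n"
    consider "j = i - 1" | "j = i" | "j \<noteq> i - 1" "j \<noteq> i" by blast
    then show "?g (l[j := x + y]) - ?g (l[j := x]) - ?g (l[j := y]) \<in> trel sc"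
    proof cases
      case 3
      then show ?thesis using Iadd[OF l j 3] f by (simp add: tlin_def)
    qed (use l i in \<open>auto simp: Iupd plinear_diff[OF IL, symmetric] intro!: Itr fadd r2\<close>)
  next
    fix l :: "'m list" and j c x
    assume l: "length l = n" and j: "j < n"
    consider "j = i - 1" | "j = i" | "j \<noteq> i - 1" "j \<noteq> i" by blast
    then show "?g (l[j := sc c x]) - pscale c (?g (l[j := x])) \<in> trel sc"
    proof cases
      case 3
      then show ?thesis using Ismul[OF l j 3] f by (simp add: tlin_def)
    qed (use l i in \<open>auto simp: Iupd plinear_diff[OF IL, symmetric] plinear_pscale[OF IL, symmetric]
        intro!: Itr fsm r2\<close>)
  qed
  then show ?thesis by (simp add: slot_def I_def)
qed

text \<open>An equality of representatives: on a single word both sides are the same double sum over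
  the two inserted words, with the stretch \<open>?C\<close> between the slots untouched.
  \<open>tlin\<close> guarantees that insertions have length two and therefore do not displace the
  other slot.\<close>

lemma slot_commute:
  fixes f g :: "('m::ab_group_add list \<Rightarrow>\<^sub>0 'k::comm_ring_1) \<Rightarrow> ('m list \<Rightarrow>\<^sub>0 'k)"
  assumes f: "tlin sc 2 f" and g: "tlin sc 2 g" and ij: "1 \<le> i" "i + 2 \<le> j" "j < n" and v: "tsupp n v"
  shows "slot i f (slot j g v) = slot j g (slot i f v)"
proof (rule plinear_eqI[where F = "\<lambda>v. slot i f (slot j g v)"])
  fix l assume "l \<in> Poly_Mapping.keys v"
  then have l: "length l = n" using v by (simp add: tsupp_def)
  have len: "length p = 2" if "tlin sc 2 k" "p \<in> Poly_Mapping.keys (k (pure [a, b]))"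
    for k :: "('m list \<Rightarrow>\<^sub>0 'k) \<Rightarrow> ('m list \<Rightarrow>\<^sub>0 'k)" and p a b
  proof -
    have "tsupp 2 (k (pure [a, b]))" using that(1) by (simp add: tlin_def)
    with that(2) show ?thesis by (simp add: tsupp_def)
  qed
  let ?A = "take (i - 1) l" and ?C = "drop (i + 1) (take (j - 1) l)" and ?D = "drop (j + 1) l"
  let ?u = "f (pure [l ! (i - 1), l ! i])" and ?w = "g (pure [l ! (j - 1), l ! j])"
  have "slot i f (slot j g (pure l)) = plin (\<lambda>q. plin (\<lambda>p. pure (?A @ p @ ?C @ q @ ?D)) ?u) ?w"
    unfolding slot_def plin_pure plinear_plin_plin[OF plinear_plin]
    using l ij len[OF g]
    by (intro plin_cong) (auto simp: nth_append min_def intro!: plin_cong)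
  also have "\<dots> = plin (\<lambda>p. plin (\<lambda>q. pure (?A @ p @ ?C @ q @ ?D)) ?w) ?u"
    by (rule plin_swap)
  also have "\<dots> = slot j g (slot i f (pure l))"
  proof -
    have *: "plin (\<lambda>q. pure (take (j - 1) (?A @ p @ drop (i + 1) l) @ q @ drop (j + 1) (?A @ p @ drop (i + 1) l)))
         (g (pure [(?A @ p @ drop (i + 1) l) ! (j - 1), (?A @ p @ drop (i + 1) l) ! j]))
        = plin (\<lambda>q. pure (?A @ p @ ?C @ q @ ?D)) ?w" if p: "length p = 2" for p
    proof -
      have nth: "(?A @ p @ drop (i + 1) l) ! k = l ! k" if k: "i + 1 \<le> k" "k < n" for k
      proof -
        from k obtain m where m: "k = i + 1 + m" using le_Suc_ex by blast
        from ij obtain i' where i': "i = Suc i'" by (cases i) auto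
        show ?thesis using l k p by (simp add: m i' nth_append min_def)
      qed
      have "take (j - 1) (?A @ p @ drop (i + 1) l) = ?A @ p @ ?C"
        using l ij p by (simp add: drop_take)
      moreover have "drop (j + 1) (?A @ p @ drop (i + 1) l) = ?D"
        using l ij p by simp
      moreover have "(?A @ p @ drop (i + 1) l) ! (j - 1) = l ! (j - 1)" "(?A @ p @ drop (i + 1) l) ! j = l ! j"
        using nth[of "j - 1"] nth[of j] ij by simp_all
      ultimately show ?thesis by simp
    qed
    show ?thesis
      unfolding slot_def plin_pure plinear_plin_plin[OF plinear_plin]
      using len[OF f] by (intro plin_cong, subst *) simp_all
  qed
  finally show "slot i f (slot j g (pure l)) = slot j g (slot i f (pure l))" .
qed (rule plinear_comp[OF plinear_slot plinear_slot])+

section \<open>The factorwise action on tensor powers\<close>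

lemma plinear_tact: "plinear (tact act X)"
proof -
  have "tact act X v = (\<Sum>l\<in>Poly_Mapping.keys X. pscale (Poly_Mapping.lookup X l) (plin (\<lambda>l'. pure (map2 act l l')) v))" for v
    by (simp add: tact_def plin_def)
  then show ?thesis
    by (auto intro!: plinearI
        simp: plinear_add[OF plinear_plin] plinear_pscale[OF plinear_plin] pscale_add_right sum.distrib
          pscale_sum_right mult.commute)
qed

lemma plinear_tact_left: "plinear (\<lambda>X. tact act X v)"
  unfolding tact_def by (rule plinear_plin)

lemma tact_pure: "tact act (pure l) (pure l') = pure (map2 act l l')"
  by (simp add: tact_def)

lemma tsupp_tact: "tsupp n X \<Longrightarrow> tsupp n v \<Longrightarrow> tsupp n (tact act X v)"
  unfolding tact_def by (intro tsupp_plin) (auto simp: tsupp_def)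

text \<open>Trilinearity reduces the claim to words. There \<open>map2\<close> truncates both sides
  to the shortest of the three, so it holds across all degrees.\<close>

lemma tact_assoc:
  assumes "\<And>a b m. act (mul a b) m = act a (act b m)"
  shows "tact act (tact mul X Y) v = tact act X (tact act Y v)"
proof -
  have *: "map2 act (map2 mul l l') l'' = map2 act l (map2 act l' l'')" for l l' l''
    by (rule nth_equalityI) (auto simp: assms)
  have 1: "tact act (tact mul (pure l) (pure l')) v = tact act (pure l) (tact act (pure l') v)" for l l'
    using plinear_eqI[where F = "tact act (tact mul (pure l) (pure l'))"
        and G = "\<lambda>v. tact act (pure l) (tact act (pure l') v)" and v = v]
    by (simp add: plinear_tact plinear_comp[where F = "tact act _" and G = "tact act _"] tact_pure *)
  have 2: "tact act (tact mul (pure l) Y) v = tact act (pure l) (tact act Y v)" for l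
    using plinear_eqI[where F = "\<lambda>Y. tact act (tact mul (pure l) Y) v"
        and G = "\<lambda>Y. tact act (pure l) (tact act Y v)" and v = Y]
    by (simp add: plinear_comp[OF plinear_tact_left[of act v] plinear_tact[of mul]]
        plinear_comp[OF plinear_tact[of act] plinear_tact_left[of act v]] 1)
  show ?thesis
    using plinear_eqI[where F = "\<lambda>X. tact act (tact mul X Y) v"
        and G = "\<lambda>X. tact act X (tact act Y v)" and v = X]
    by (simp add: plinear_comp[OF plinear_tact_left[of act v] plinear_tact_left[of mul Y]]
        plinear_tact_left 2)
qed

text \<open>With \<open>tact_trel_left\<close> this makes the action descend to tensor powers:
  letters are multiplied position by position, so a relation in letter \<open>i\<close> of one
  argument turns into a relation in letter \<open>i\<close> of the result.\<close>

lemma tact_trel_right: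
  assumes X: "tsupp n X" and u: "u \<in> trel sc" "tsupp n u"
    and add: "\<And>a m m'. act a (m + m') = act a m + act a m'"
    and smul: "\<And>a c m. act a (sc c m) = sc c (act a m)"
  shows "tact act X u \<in> trel sc"
proof (rule plinear_in_trelI[of "\<lambda>X. tact act X u", OF plinear_tact_left])
  fix l assume "l \<in> Poly_Mapping.keys X"
  then have l: "length l = n" using X by (simp add: tsupp_def)
  have upd: "map2 act l (l'[i := x]) = (map2 act l l')[i := act (l ! i) x]" if "length l' = n" "i < n" for l' i x
    using l that by (intro nth_equalityI) (auto simp: nth_list_update)
  show "tact act (pure l) u \<in> trel sc"
    unfolding tact_def plin_pure
    by (rule plin_trel[OF u]) (use l in \<open>auto simp: upd add smul intro!: rel_add rel_smul\<close>)
qed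

lemma tact_trel_left:
  fixes sc' :: "'k::comm_ring_1 \<Rightarrow> 'b::ab_group_add \<Rightarrow> 'b"
  assumes u: "tsupp n u" and X: "X \<in> trel sc'" "tsupp n X"
    and add: "\<And>a a' m. act (a + a') m = act a m + act a' m"
    and smul: "\<And>c a m. act (sc' c a) m = sc c (act a m)"
  shows "tact act X u \<in> trel sc"
  unfolding tact_def
proof (rule plin_trel[OF X])
  note L = plinear_plin
  fix l :: "'b list" and i
  assume l: "length l = n" and i: "i < n"
  have upd: "map2 act (l[i := x]) l' = (map2 act l l')[i := act x (l' ! i)]" if "length l' = n" for l' x
    using l that i by (intro nth_equalityI) (auto simp: nth_list_update)
  have len: "length l' = n" if "l' \<in> Poly_Mapping.keys u" for l'
    using u that by (simp add: tsupp_def)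
  show "plin (\<lambda>l'. pure (map2 act (l[i := x + y]) l')) u
       - plin (\<lambda>l'. pure (map2 act (l[i := x]) l')) u
       - plin (\<lambda>l'. pure (map2 act (l[i := y]) l')) u \<in> trel sc" for x y
    by (rule plinear_in_trelI[OF plinear_minus[OF plinear_minus[OF L L] L]])
      (use l i len in \<open>auto simp: upd add intro!: rel_add\<close>)
  show "plin (\<lambda>l'. pure (map2 act (l[i := sc' c x]) l')) u
       - pscale c (plin (\<lambda>l'. pure (map2 act (l[i := x]) l')) u) \<in> trel sc" for c x
    by (rule plinear_in_trelI[OF plinear_minus[OF L plinear_scaled[OF L]]])
      (use l i len in \<open>auto simp: upd smul intro!: rel_smul\<close>)
qed

lemma tsupp_emb:
  assumes "1 \<le> i" "i < d" "tsupp 2 Z"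
  shows "tsupp d (emb d i Z)"
  unfolding emb_def using assms by (intro tsupp_plin) (auto simp: tsupp_def)

lemma tsupp_tone [simp]: "tsupp d (tone d)"
  by (simp add: tone_def)

lemma tact_tone:
  assumes "\<And>m. act 1 m = m" "tsupp d v"
  shows "tact act (tone d) v = v"
proof (rule plinear_eqI[of "tact act (tone d)" "\<lambda>v. v", OF plinear_tact plinear_id])
  fix l assume "l \<in> Poly_Mapping.keys v"
  then have "map2 act (replicate d 1) l = l"
    using assms by (intro nth_equalityI) (auto simp: tsupp_def)
  then show "tact act (tone d) (pure l) = pure l"
    by (simp add: tone_def tact_pure)
qed

subsection \<open>Reduced expressions\<close>

lemma sref_apply: "sref i k = (if k = i then Suc i else if k = Suc i then i else k)"
  by (simp add: sref_def transpose_def)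

lemma sref_sref [simp]: "sref i (sref i k) = k"
  by (simp add: sref_def)

lemma sref_comp_sref [simp]: "sref i \<circ> (sref i \<circ> w) = w"
  by (simp add: fun_eq_iff)

lemma sref_Sym: "i \<in> {1..<d} \<Longrightarrow> sref i \<in> Sym d"
  unfolding Sym_def sref_def by (auto intro: permutes_swap_id)

lemma id_Sym [simp]: "id \<in> Sym d"
  by (simp add: Sym_def permutes_id)

lemma finite_Sym [simp]: "finite (Sym d)"
  by (simp add: Sym_def finite_permutations)

lemma sref_comp_Sym [simp]: "i \<in> {1..<d} \<Longrightarrow> w \<in> Sym d \<Longrightarrow> sref i \<circ> w \<in> Sym d"
  using sref_Sym[of i d] by (auto simp: Sym_def intro: permutes_compose)

lemma word_perm_simps [simp]:
  "word_perm [] = id" "word_perm (i # ws) = sref i \<circ> word_perm ws"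
  by (simp_all add: word_perm_def)

lemma word_perm_Sym: "set ws \<subseteq> {1..<d} \<Longrightarrow> word_perm ws \<in> Sym d"
  by (induction ws) simp_all

lemma Sym_bij: "w \<in> Sym d \<Longrightarrow> bij w"
  by (auto simp: Sym_def dest: permutes_bij)

lemma inv_sref_comp: "w \<in> Sym d \<Longrightarrow> inv (sref i \<circ> w) k = inv w (sref i k)"
  by (rule inv_f_eq) (auto dest!: Sym_bij simp: inj_compose sref_def bij_is_inj bij_is_surj surj_f_inv_f)

lemma inv_Sym_neq: "w \<in> Sym d \<Longrightarrow> inv w i \<noteq> inv w (Suc i)"
  by (metis Sym_bij bij_inv_eq_iff n_not_Suc_n)

text \<open>Left multiplication by \<open>sref i\<close> exchanges the values i and i + 1, which sit
  at the positions \<open>a < b\<close>. No value lies between them, so \<open>(a, b)\<close> is the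
  only pair whose order changes, and it becomes an inversion.\<close>

lemma perm_len_up:
  assumes w: "w \<in> Sym d" and i: "i \<in> {1..<d}" and up: "inv w i < inv w (Suc i)"
  shows "perm_len d (sref i \<circ> w) = Suc (perm_len d w)"
proof -
  define a b where "a = inv w i" and "b = inv w (Suc i)"
  have wp: "w permutes {1..d}" using w by (simp add: Sym_def)
  have wa: "w x = i \<longleftrightarrow> x = a" and wb: "w x = Suc i \<longleftrightarrow> x = b" for x
    using bij_inv_eq_iff[OF Sym_bij[OF w]] by (auto simp: a_def b_def)
  have ab: "1 \<le> a" "a < b" "b \<le> d"
    using up i permutes_in_image[OF wp, of a] permutes_in_image[OF wp, of b] wa[of a] wb[of b]
    by (auto simp: a_def b_def)
  let ?I = "{(i, j). 1 \<le> i \<and> i < j \<and> j \<le> d \<and> w j < w i}"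
  have key: "sref i (w y) < sref i (w x) \<longleftrightarrow> (x = a \<and> y = b) \<or> w y < w x" if "x < y" for x y
    using wa[of x] wb[of x] wa[of y] wb[of y] ab that by (auto simp: sref_apply)
  have eq: "{(x, y). 1 \<le> x \<and> x < y \<and> y \<le> d \<and> (sref i \<circ> w) y < (sref i \<circ> w) x} = insert (a, b) ?I"
    using key ab by auto
  have "finite ?I" by (rule finite_subset[of _ "{1..d} \<times> {1..d}"]) auto
  moreover have "(a, b) \<notin> ?I" using wa[of a] wb[of b] by auto
  ultimately show ?thesis unfolding perm_len_def eq by simp
qed

lemma perm_len_down:
  assumes w: "w \<in> Sym d" and i: "i \<in> {1..<d}" and down: "inv w (Suc i) < inv w i"
  shows "perm_len d w = Suc (perm_len d (sref i \<circ> w))"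
  using perm_len_up[OF sref_comp_Sym[OF i w] i] down inv_sref_comp[OF w, of i]
  by (simp add: sref_apply)

lemma perm_len_sref_cases:
  assumes "w \<in> Sym d" "i \<in> {1..<d}"
  obtains "inv w i < inv w (Suc i)" "perm_len d (sref i \<circ> w) = Suc (perm_len d w)"
  | "inv w (Suc i) < inv w i" "perm_len d w = Suc (perm_len d (sref i \<circ> w))"
  using perm_len_up[OF assms] perm_len_down[OF assms] inv_Sym_neq[OF assms(1), of i] by (metis linorder_neqE)

lemma perm_len_id [simp]: "perm_len d id = 0"
proof -
  have "{(i, j). 1 \<le> i \<and> i < j \<and> j \<le> d \<and> id j < id i} = {}" by auto
  then show ?thesis unfolding perm_len_def by (metis card.empty)
qed

text \<open>Without a descent \<open>inv w\<close> increases on 1, ..., d, hence k \<le>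
  \<open>inv w k\<close> throughout, and a permutation with this property is the identity.\<close>

lemma exists_descent:
  assumes w: "w \<in> Sym d" and "w \<noteq> id"
  shows "\<exists>i\<in>{1..<d}. inv w (Suc i) < inv w i"
proof (rule ccontr)
  assume "\<not> ?thesis"
  then have up: "inv w i < inv w (Suc i)" if "i \<in> {1..<d}" for i
    using that inv_Sym_neq[OF w, of i] by (metis linorder_neqE)
  have p: "inv w permutes {1..d}" using w by (simp add: Sym_def permutes_inv)
  have "k \<le> inv w k" if "k \<in> {1..d}" for k
    using that
  proof (induction k)
    case (Suc k)
    show ?case
    proof (cases "k = 0")
      case True
      then show ?thesis using Suc.prems permutes_in_image[OF p, of 1] by simp
    next
      case False
      then show ?thesis using Suc up[of k] by simp
    qed
  qed simp
  then have "inv w = id" using permutes_natset_ge[OF p] by blast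
  then show False using assms Sym_bij[OF w] by (metis inv_id inv_inv_eq)
qed

lemma perm_len_eq_0: "w \<in> Sym d \<Longrightarrow> perm_len d w = 0 \<longleftrightarrow> w = id"
  using exists_descent perm_len_down by fastforce

lemma perm_len_sref_le:
  "w \<in> Sym d \<Longrightarrow> i \<in> {1..<d} \<Longrightarrow> perm_len d (sref i \<circ> w) \<le> Suc (perm_len d w)"
  by (metis perm_len_sref_cases nle_le not_less_eq_eq le_SucI)

lemma perm_len_word_perm_le: "set ws \<subseteq> {1..<d} \<Longrightarrow> perm_len d (word_perm ws) \<le> length ws"
proof (induction ws)
  case Nil
  show ?case by (simp only: word_perm_simps perm_len_id)
next
  case (Cons i ws)
  have "word_perm ws \<in> Sym d" "i \<in> {1..<d}"
    using Cons.prems by (auto simp only: set_simps insert_subset intro: word_perm_Sym)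
  then have "perm_len d (sref i \<circ> word_perm ws) \<le> Suc (perm_len d (word_perm ws))"
    by (rule perm_len_sref_le)
  also have "\<dots> \<le> Suc (length ws)" using Cons by simp
  finally show ?case unfolding word_perm_simps length_Cons .
qed

lemma reduced_expr_Sym: "reduced_expr d ws w \<Longrightarrow> w \<in> Sym d"
  unfolding reduced_expr_def using word_perm_Sym by blast

lemma reduced_expr_Nil [simp]: "reduced_expr d [] w \<longleftrightarrow> w = id"
  by (auto simp: reduced_expr_def)

text \<open>The first letter must be a descent: at an ascent, \<open>sref i \<circ> w\<close> would
  be longer than \<open>w\<close>, although it is spelled by the shorter word
  \<open>ws\<close>.\<close>

lemma reduced_expr_Cons:
  assumes w: "w \<in> Sym d"
  shows "reduced_expr d (i # ws) w \<longleftrightarrow>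
     i \<in> {1..<d} \<and> inv w (Suc i) < inv w i \<and> reduced_expr d ws (sref i \<circ> w)"
proof
  assume r: "reduced_expr d (i # ws) w"
  then have i: "i \<in> {1..<d}" and ws: "set ws \<subseteq> {1..<d}" and eq: "sref i \<circ> word_perm ws = w"
    and len: "Suc (length ws) = perm_len d w"
    by (auto simp: reduced_expr_def)
  have eq': "word_perm ws = sref i \<circ> w" using eq by auto
  have le: "perm_len d (sref i \<circ> w) \<le> length ws" using perm_len_word_perm_le[OF ws] eq' by simp
  show "i \<in> {1..<d} \<and> inv w (Suc i) < inv w i \<and> reduced_expr d ws (sref i \<circ> w)"
    using w i
  proof (cases rule: perm_len_sref_cases)
    case 1
    then show ?thesis using le len by simp
  next
    case 2
    then show ?thesis using len eq' ws i by (simp add: reduced_expr_def)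
  qed
next
  assume "i \<in> {1..<d} \<and> inv w (Suc i) < inv w i \<and> reduced_expr d ws (sref i \<circ> w)"
  then show "reduced_expr d (i # ws) w"
    using perm_len_down[OF w, of i] by (auto simp: reduced_expr_def)
qed

lemma exists_reduced_expr:
  assumes "w \<in> Sym d"
  shows "\<exists>ws. reduced_expr d ws w"
  using assms
proof (induction "perm_len d w" arbitrary: w)
  case 0
  then have "w = id" using perm_len_eq_0[of w d] by simp
  then have "reduced_expr d [] w" by (simp only: reduced_expr_Nil)
  then show ?case ..
next
  case (Suc n)
  then obtain i where i: "i \<in> {1..<d}" "inv w (Suc i) < inv w i"
    using exists_descent[of w d] by fastforce
  have "n = perm_len d (sref i \<circ> w)" using Suc.hyps(2) perm_len_down[OF Suc.prems i] by simp
  then obtain ws where "reduced_expr d ws (sref i \<circ> w)"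
    using Suc.hyps(1) sref_comp_Sym[OF i(1) Suc.prems] by blast
  then have "reduced_expr d (i # ws) w" using reduced_expr_Cons[OF Suc.prems] i by blast
  then show ?case ..
qed

lemma reduced_expr_rexp: "w \<in> Sym d \<Longrightarrow> reduced_expr d (rexp d w) w"
  unfolding rexp_def by (rule someI_ex[OF exists_reduced_expr])

text \<open>The second ground module axiom quantifies over choice maps and would be vacuous without
  one; the converse direction rests on this existence. The map strips one selected descent after
  another.\<close>

lemma exists_choice_map: "\<exists>r. choice_map d r"
proof -
  define D where "D = (\<lambda>w :: nat \<Rightarrow> nat. SOME i. i \<in> {1..<d} \<and> inv w (Suc i) < inv w i)"
  have D: "D w \<in> {1..<d}" "inv w (Suc (D w)) < inv w (D w)" if "w \<in> Sym d" "w \<noteq> id" for w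
    using someI_ex[of "\<lambda>i. i \<in> {1..<d} \<and> inv w (Suc i) < inv w i"] exists_descent[OF that]
    unfolding D_def Bex_def by blast+
  \<comment> \<open>Recursion on the number of letters still to be produced, with the permutation as
    parameter; started at \<open>perm_len d w\<close> it stops exactly at the identity.\<close>
  define cm where "cm = rec_nat (\<lambda>w. []) (\<lambda>n f w. D w # f (sref (D w) \<circ> w))"
  have cm: "cm 0 w = []" "cm (Suc n) w = D w # cm n (sref (D w) \<circ> w)" for n w
    by (simp_all add: cm_def)
  let ?r = "\<lambda>w. cm (perm_len d w) w"
  have step: "?r w = D w # ?r (sref (D w) \<circ> w)" if "w \<in> Sym d" "w \<noteq> id" for w
    using perm_len_down[OF that(1) D[OF that]] by (simp add: cm)
  have "reduced_expr d (?r w) w" if "w \<in> Sym d" for w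
    using that
  proof (induction "perm_len d w" arbitrary: w)
    case 0
    then have "w = id" using perm_len_eq_0 by metis
    then show ?case by (simp only: perm_len_id cm reduced_expr_Nil)
  next
    case (Suc n)
    then have ne: "w \<noteq> id" by auto
    note Dw = D[OF Suc.prems ne]
    have "reduced_expr d (?r (sref (D w) \<circ> w)) (sref (D w) \<circ> w)"
      using Suc Dw perm_len_down[OF Suc.prems Dw] by simp
    then show ?case unfolding step[OF Suc.prems ne] reduced_expr_Cons[OF Suc.prems] using Dw by blast
  qed
  moreover have "\<exists>i. ?r w = i # ?r (sref i \<circ> w) \<and> perm_len d (sref i \<circ> w) = perm_len d w - 1"
    if "w \<in> Sym d" "w \<noteq> id" for w
    using step[OF that] perm_len_down[OF that(1) D[OF that]] by (intro exI[of _ "D w"]) simp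
  ultimately have "choice_map d ?r" by (simp add: choice_map_def cm)
  then show ?thesis by blast
qed

lemma choice_map_sref:
  assumes r: "choice_map d r" and i: "i \<in> {1..<d}"
  shows "r (sref i) = [i]"
proof -
  have s: "sref i \<in> Sym d" using i by (rule sref_Sym)
  have red: "reduced_expr d (r (sref i)) (sref i)" using r s by (simp add: choice_map_def)
  have "perm_len d (sref i) = 1"
    using perm_len_up[of id d i] i by simp
  then obtain k where k: "r (sref i) = [k]"
    using red by (auto simp: reduced_expr_def length_Suc_conv)
  then have "sref k = sref i" using red by (simp add: reduced_expr_def)
  then have "sref k k = sref i k" by simp
  then have "k = i" by (auto simp: sref_apply split: if_splits)
  then show ?thesis using k by simp
qed

section \<open>Braid moves and Matsumoto's theorem\<close>

inductive braid_eq :: "nat list \<Rightarrow> nat list \<Rightarrow> bool" where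
  refl: "braid_eq u u"
| sym: "braid_eq u v \<Longrightarrow> braid_eq v u"
| trans: "braid_eq u v \<Longrightarrow> braid_eq v w \<Longrightarrow> braid_eq u w"
| comm: "i + 2 \<le> j \<Longrightarrow> braid_eq (a @ [i, j] @ b) (a @ [j, i] @ b)"
| braid: "braid_eq (a @ [i, Suc i, i] @ b) (a @ [Suc i, i, Suc i] @ b)"

lemma braid_eq_Cons: "braid_eq u v \<Longrightarrow> braid_eq (i # u) (i # v)"
proof (induction rule: braid_eq.induct)
  case (comm k j a b)
  then show ?case using braid_eq.comm[of k j "i # a" b] by simp
next
  case (braid a k b)
  then show ?case using braid_eq.braid[of "i # a" k b] by simp
qed (blast intro: braid_eq.intros)+

text \<open>Keeps the intermediate words of a chain of moves inside \<open>{1..<d}\<close>, the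
  range in which the generators are known to satisfy the braid relations.\<close>

lemma braid_eq_set: "braid_eq u v \<Longrightarrow> set u = set v"
  by (induction rule: braid_eq.induct) auto

lemma sref_commute: "i + 2 \<le> j \<Longrightarrow> sref j \<circ> (sref i \<circ> w) = sref i \<circ> (sref j \<circ> w)"
  by (auto simp: fun_eq_iff sref_apply)

lemma sref_braid: "sref i \<circ> (sref (Suc i) \<circ> (sref i \<circ> w)) = sref (Suc i) \<circ> (sref i \<circ> (sref (Suc i) \<circ> w))"
  by (auto simp: fun_eq_iff sref_apply)

text \<open>Matsumoto's theorem: two distinct descents i, j of w let w be factored through the longest
  element of the parabolic subgroup they generate, and its two reduced words are related by one
  braid move.\<close>
theorem reduced_expr_braid_eq:
  assumes "reduced_expr d u w" "reduced_expr d v w"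
  shows "braid_eq u v"
  using assms
proof (induction "length u" arbitrary: u v w)
  case 0
  then have "u = []" "w = id" by auto
  with 0 have "v = []" by (auto simp: reduced_expr_def simp del: id_apply)
  with \<open>u = []\<close> show ?case by (simp add: braid_eq.refl)
next
  case (Suc n)
  note w = reduced_expr_Sym[OF Suc.prems(1)]
  have IH: "braid_eq x y" if "reduced_expr d x z" "reduced_expr d y z" "length x = n" for x y z
    using Suc.hyps(1)[of x z y] that by simp
  have wlog: "braid_eq (i # u') (j # v')"
    if ij: "i < j" and ru: "reduced_expr d (i # u') w" and rv: "reduced_expr d (j # v') w"
      and lu: "length u' = n" for i j u' v'
  proof -
    have i: "i \<in> {1..<d}" "inv w (Suc i) < inv w i" "reduced_expr d u' (sref i \<circ> w)"
      and j: "j \<in> {1..<d}" "inv w (Suc j) < inv w j" "reduced_expr d v' (sref j \<circ> w)"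
      using ru rv by (simp_all add: reduced_expr_Cons[OF w])
    have lv: "length v' = n" using ru rv lu by (simp add: reduced_expr_def)
    note simps = reduced_expr_Cons inv_sref_comp[of _ d] w
    show ?thesis
    proof (cases "j = Suc i")
      case False
      with ij have far: "i + 2 \<le> j" by simp
      \<comment> \<open>Distant descents do not disturb each other: \<open>j\<close> is still a
        descent after removing \<open>i\<close>, and conversely. So the common remainder
        \<open>t\<close> extends to reduced words of both shortened permutations, to which the
        induction hypothesis applies.\<close>
      obtain t where "reduced_expr d t (sref j \<circ> (sref i \<circ> w))"
        using exists_reduced_expr i(1) j(1) w by (metis sref_comp_Sym)
      then have "reduced_expr d (j # t) (sref i \<circ> w)" "reduced_expr d (i # t) (sref j \<circ> w)"
        using i j far by (simp_all add: simps sref_commute) (simp_all add: sref_apply)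
      then have "braid_eq u' (j # t)" "braid_eq v' (i # t)"
        using IH[OF i(3) _ lu] IH[OF j(3) _ lv] by blast+
      then have "braid_eq (i # u') (i # j # t)" "braid_eq (j # v') (j # i # t)"
        by (auto intro: braid_eq_Cons)
      moreover have "braid_eq (i # j # t) (j # i # t)"
        using braid_eq.comm[OF far, of "[]" t] by simp
      ultimately show ?thesis by (blast intro: braid_eq.trans braid_eq.sym)
    next
      case True
      \<comment> \<open>What remains of \<open>w\<close> once the longest element of the group
        generated by the two adjacent reflections is split off; by \<open>sref_braid\<close> it is
        the same whichever reflection is removed first.\<close>
      obtain t where t: "reduced_expr d t (sref i \<circ> (sref j \<circ> (sref i \<circ> w)))"
        using exists_reduced_expr i(1) j(1) w by (metis sref_comp_Sym)
      then have t': "reduced_expr d t (sref j \<circ> (sref i \<circ> (sref j \<circ> w)))"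
        unfolding True sref_braid .
      have "reduced_expr d (j # i # t) (sref i \<circ> w)" "reduced_expr d (i # j # t) (sref j \<circ> w)"
        using i j t t' True by (simp_all add: simps) (simp_all add: sref_apply)
      then have "braid_eq u' (j # i # t)" "braid_eq v' (i # j # t)"
        using IH[OF i(3) _ lu] IH[OF j(3) _ lv] by blast+
      then have "braid_eq (i # u') (i # j # i # t)" "braid_eq (j # v') (j # i # j # t)"
        by (auto intro: braid_eq_Cons)
      moreover have "braid_eq (i # j # i # t) (j # i # j # t)"
        using braid_eq.braid[of "[]" i t] True by simp
      ultimately show ?thesis by (blast intro: braid_eq.trans braid_eq.sym)
    qed
  qed
  obtain i u' where u: "u = i # u'" "length u' = n" using Suc.hyps(2) by (cases u) auto
  have "length v = Suc n" using Suc.prems Suc.hyps(2) by (simp add: reduced_expr_def)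
  then obtain j v' where v: "v = j # v'" "length v' = n" by (cases v) auto
  consider "i = j" | "i < j" | "j < i" by linarith
  then show ?case
  proof cases
    case 1
    then have "braid_eq u' v'"
      using Suc.hyps(1) Suc.prems u v by (metis reduced_expr_Cons w)
    then show ?thesis unfolding u v 1 by (rule braid_eq_Cons)
  next
    case 2
    then show ?thesis using wlog Suc.prems u v by blast
  next
    case 3
    then show ?thesis using wlog Suc.prems u v braid_eq.sym by blast
  qed
qed

section \<open>Products of generators along reduced words\<close>

lemma gen_prod_simps [simp]:
  "gen_prod g [] = 1" "gen_prod g (i # ws) = g i * gen_prod g ws"
  by (simp_all add: gen_prod_def)

lemma gen_prod_append: "gen_prod g (u @ v) = gen_prod g u * gen_prod g v"
  by (induction u) (simp_all add: mult.assoc)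

text \<open>Used for both families of generators, the \<open>h i\<close> of the Hecke algebra and
  the \<open>H i\<close> of the wreath product, which share nothing but these relations.\<close>

locale braided =
  fixes d :: nat and g :: "nat \<Rightarrow> 'a::monoid_mult"
  assumes braid_rel: "\<forall>k. 1 \<le> k \<and> k + 1 < d \<longrightarrow> g k * g (k + 1) * g k = g (k + 1) * g k * g (k + 1)"
    and comm_rel: "\<forall>i j. i \<in> {1..<d} \<and> j \<in> {1..<d} \<and> (i + 2 \<le> j \<or> j + 2 \<le> i) \<longrightarrow> g i * g j = g j * g i"
begin

lemma gen_prod_braid_eq: "braid_eq u v \<Longrightarrow> set u \<subseteq> {1..<d} \<Longrightarrow> gen_prod g u = gen_prod g v"
proof (induction rule: braid_eq.induct)
  case (sym u v)
  then show ?case using braid_eq_set by fastforce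
next
  case (trans u v w)
  then show ?case using braid_eq_set by fastforce
next
  case (comm i j a b)
  then have "g i * g j = g j * g i" using comm_rel[rule_format, of i j] by simp
  then show ?case by (simp add: gen_prod_append mult.assoc[symmetric])
next
  case (braid a i b)
  then have "g i * g (Suc i) * g i = g (Suc i) * g i * g (Suc i)" using braid_rel[rule_format, of i] by simp
  then show ?case by (simp add: gen_prod_append mult.assoc[symmetric])
qed simp

text \<open>Removes the arbitrary choice of \<open>rexp\<close>: any two reduced words are joined by
  braid moves, and \<open>g\<close> respects these.\<close>

lemma gw_reduced: "reduced_expr d ws w \<Longrightarrow> gw d g w = gen_prod g ws"
  unfolding gw_def
  by (intro gen_prod_braid_eq reduced_expr_braid_eq[of d _ w] reduced_expr_rexp reduced_expr_Sym)
    (use reduced_expr_rexp[OF reduced_expr_Sym] in \<open>auto simp: reduced_expr_def\<close>)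

lemma gw_id [simp]: "gw d g id = 1"
  using gw_reduced[of "[]" id] by simp

lemma gw_up:
  assumes "w \<in> Sym d" "i \<in> {1..<d}" "inv w i < inv w (Suc i)"
  shows "gw d g (sref i \<circ> w) = g i * gw d g w"
proof -
  have "reduced_expr d (i # rexp d w) (sref i \<circ> w)"
    using assms inv_sref_comp[OF assms(1), of i] reduced_expr_rexp[OF assms(1)]
    by (simp add: reduced_expr_Cons sref_apply)
  from gw_reduced[OF this] show ?thesis by (simp add: gw_def)
qed

lemma gw_sref [simp]: "i \<in> {1..<d} \<Longrightarrow> gw d g (sref i) = g i"
  using gw_up[of id i] by simp

lemma gw_down:
  assumes "w \<in> Sym d" "i \<in> {1..<d}" "inv w (Suc i) < inv w i"
  shows "gw d g w = g i * gw d g (sref i \<circ> w)"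
  using gw_up[of "sref i \<circ> w" i] assms inv_sref_comp[OF assms(1), of i]
  by (simp add: sref_apply)

end

subsection \<open>Operators on M \<otimes> H~\<close>

lemma sum_fun_apply: "(\<Sum>a\<in>A. f a) z = (\<Sum>a\<in>A. f a z)"
  for f :: "'a \<Rightarrow> 'b \<Rightarrow> 'c::comm_monoid_add"
  by (induction A rule: infinite_finite_induct) auto

lemma heq_refl [simp]: "heq sc d T T"
  by (simp add: heq_def)

lemma heq_sym: "heq sc d T U \<Longrightarrow> heq sc d U T"
  by (simp add: heq_def teq_sym)

lemma heq_trans [trans]: "heq sc d T U \<Longrightarrow> heq sc d U V \<Longrightarrow> heq sc d T V"
  unfolding heq_def using teq_trans by blast

lemma heq_add: "heq sc d T T' \<Longrightarrow> heq sc d U U' \<Longrightarrow> heq sc d (T + U) (T' + U')"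
  by (simp add: heq_def teq_add)

lemma heq_sum: "(\<And>a. a \<in> A \<Longrightarrow> heq sc d (f a) (g a)) \<Longrightarrow> heq sc d (sum f A) (sum g A)"
  unfolding heq_def sum_fun_apply by (auto intro: teq_sum)

lemma heq_agree: "(\<And>z. z \<in> Sym d \<Longrightarrow> T z = U z) \<Longrightarrow> heq sc d T U"
  by (simp add: heq_def)

definition hsupp :: "nat \<Rightarrow> ('m, 'k::comm_ring_1) mh \<Rightarrow> bool" where
  "hsupp d T \<longleftrightarrow> (\<forall>z\<in>Sym d. tsupp d (T z))"

lemma hsupp_add: "hsupp d T \<Longrightarrow> hsupp d U \<Longrightarrow> hsupp d (T + U)"
  by (simp add: hsupp_def tsupp_add)

lemma hsupp_sum: "(\<And>a. a \<in> A \<Longrightarrow> hsupp d (f a)) \<Longrightarrow> hsupp d (sum f A)"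
  unfolding hsupp_def sum_fun_apply by (auto intro: tsupp_sum)

text \<open>The element m \<otimes> 1, since the basis element at \<open>id\<close> is 1.\<close>

definition hpure :: "('m list \<Rightarrow>\<^sub>0 'k::comm_ring_1) \<Rightarrow> ('m, 'k) mh" where
  "hpure m = (\<lambda>z. if z = id then m else 0)"

lemma hsupp_hpure: "tsupp d m \<Longrightarrow> hsupp d (hpure m)"
  by (simp add: hsupp_def hpure_def)

locale twisted_hecke = braided d h for d :: nat and h :: "nat \<Rightarrow> 'h::ring_1" +
  fixes sH :: "'k::comm_ring_1 \<Rightarrow> 'h \<Rightarrow> 'h" and chiS chiR :: 'k
  assumes Hk_mod: "module sH"
    and Hk_alg: "\<forall>c x y. sH c (x * y) = sH c x * y \<and> sH c (x * y) = x * sH c y"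
    and h_quad: "\<forall>i\<in>{1..<d}. h i * h i = sH chiS (h i) + sH chiR 1"
    and h_span: "\<forall>x::'h. \<exists>c. x = (\<Sum>w\<in>Sym d. sH (c w) (gw d h w))"
    and h_indep: "\<forall>c. (\<Sum>w\<in>Sym d. sH (c w) (gw d h w)) = 0 \<longrightarrow> (\<forall>w\<in>Sym d. c w = 0)"
begin

interpretation sH: module sH by (rule Hk_mod)

text \<open>hcoord is arbitrary outside Sym d; normalised to 0 there.\<close>
definition coord :: "'h \<Rightarrow> (nat \<Rightarrow> nat) \<Rightarrow> 'k" where
  "coord x z = (if z \<in> Sym d then hcoord sH h d x z else 0)"

lemma coord_expand: "x = (\<Sum>w\<in>Sym d. sH (coord x w) (gw d h w))"
proof -
  have "x = (\<Sum>w\<in>Sym d. sH (hcoord sH h d x w) (gw d h w))"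
    unfolding hcoord_def using someI_ex[OF h_span[rule_format, of x]] .
  also have "\<dots> = (\<Sum>w\<in>Sym d. sH (coord x w) (gw d h w))"
    by (intro sum.cong) (simp_all add: coord_def)
  finally show ?thesis .
qed

lemma coord_unique:
  assumes "x = (\<Sum>w\<in>Sym d. sH (c w) (gw d h w))" "z \<in> Sym d"
  shows "coord x z = c z"
proof -
  have "(\<Sum>w\<in>Sym d. sH (coord x w - c w) (gw d h w)) = x - x"
    unfolding sH.scale_left_diff_distrib sum_subtractf coord_expand[of x, symmetric] assms(1)[symmetric] ..
  then show ?thesis using h_indep[rule_format, of "\<lambda>w. coord x w - c w"] assms(2) by simp
qed

lemma coord_outside: "z \<notin> Sym d \<Longrightarrow> coord x z = 0"
  by (simp add: coord_def)

lemma coord_add: "coord (x + y) z = coord x z + coord y z"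
proof (cases "z \<in> Sym d")
  case True
  have "x + y = (\<Sum>w\<in>Sym d. sH (coord x w + coord y w) (gw d h w))"
    unfolding sH.scale_left_distrib sum.distrib coord_expand[of x, symmetric] coord_expand[of y, symmetric] ..
  from coord_unique[OF this True] show ?thesis .
qed (simp add: coord_outside)

lemma coord_scale: "coord (sH c x) z = c * coord x z"
proof (cases "z \<in> Sym d")
  case True
  have "sH c x = sH c (\<Sum>w\<in>Sym d. sH (coord x w) (gw d h w))"
    unfolding coord_expand[of x, symmetric] ..
  then have "sH c x = (\<Sum>w\<in>Sym d. sH (c * coord x w) (gw d h w))"
    by (simp add: sH.scale_sum_right)
  from coord_unique[OF this True] show ?thesis .
qed (simp add: coord_outside)

lemma coord_zero: "coord 0 z = 0"
  using coord_scale[of 0 0 z] by simp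

lemma coord_sum: "coord (sum f A) z = (\<Sum>a\<in>A. coord (f a) z)"
  by (induction A rule: infinite_finite_induct) (simp_all add: coord_add coord_zero)

lemma coord_gw: "w \<in> Sym d \<Longrightarrow> coord (gw d h w) z = of_bool (z = w)"
proof (cases "z \<in> Sym d")
  case True
  assume "w \<in> Sym d"
  then have "gw d h w = (\<Sum>v\<in>Sym d. sH (of_bool (v = w)) (gw d h v))"
    by (subst sum.mono_neutral_right[of "Sym d" "{w}"]) auto
  from coord_unique[OF this True] show ?thesis .
qed (auto simp: coord_outside)

lemma coord_one: "coord 1 z = of_bool (z = id)"
  using coord_gw[OF id_Sym] by simp

lemma coord_mult_left: "coord (x * a) z = (\<Sum>y\<in>Sym d. coord a y * coord (x * gw d h y) z)"
proof -
  have "coord (x * a) z = coord (x * (\<Sum>y\<in>Sym d. sH (coord a y) (gw d h y))) z"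
    unfolding coord_expand[of a, symmetric] ..
  also have "\<dots> = (\<Sum>y\<in>Sym d. coord a y * coord (x * gw d h y) z)"
    by (simp add: sum_distrib_left coord_sum Hk_alg[rule_format, THEN conjunct2, symmetric] coord_scale)
  finally show ?thesis .
qed

lemma coord_mult_right: "coord (a * x) z = (\<Sum>y\<in>Sym d. coord a y * coord (gw d h y * x) z)"
proof -
  have "coord (a * x) z = coord ((\<Sum>y\<in>Sym d. sH (coord a y) (gw d h y)) * x) z"
    unfolding coord_expand[of a, symmetric] ..
  also have "\<dots> = (\<Sum>y\<in>Sym d. coord a y * coord (gw d h y * x) z)"
    by (simp add: sum_distrib_right coord_sum Hk_alg[rule_format, THEN conjunct1, symmetric] coord_scale)
  finally show ?thesis .
qed

text \<open>The operator f \<otimes> (left multiplication by x).\<close>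
definition tens :: "(('m list \<Rightarrow>\<^sub>0 'k) \<Rightarrow> ('m list \<Rightarrow>\<^sub>0 'k)) \<Rightarrow> 'h \<Rightarrow> ('m, 'k) mh \<Rightarrow> ('m, 'k) mh" where
  "tens f x T = (\<lambda>z. \<Sum>y\<in>Sym d. pscale (coord (x * gw d h y) z) (f (T y)))"

text \<open>\<open>hright\<close> with the normalised \<open>coord\<close>. Outside
  \<open>Sym d\<close> it vanishes, so the identities below are equalities of functions rather than
  equalities on \<open>Sym d\<close>.\<close>

definition hmulr :: "('m, 'k) mh \<Rightarrow> 'h \<Rightarrow> ('m, 'k) mh" where
  "hmulr T x = (\<lambda>z. \<Sum>u\<in>Sym d. pscale (coord (gw d h u * x) z) (T u))"

lemma hmulr_hright: "z \<in> Sym d \<Longrightarrow> hmulr T x z = hright sH h d T x z"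
  by (simp add: hmulr_def hright_def coord_def)

lemma tens_agree: "(\<And>y. y \<in> Sym d \<Longrightarrow> T y = U y) \<Longrightarrow> tens f x T = tens f x U"
  by (simp add: tens_def)

text \<open>Associativity of the Hecke algebra in coordinates: expanding y h_u in the basis and
  multiplying by x gives the coordinates of (x y) h_u. Linearity of \<open>f\<close> is what lets it
  pass the coordinate sum.\<close>

lemma tens_comp:
  assumes "plinear f"
  shows "tens f x (tens g y T) = tens (\<lambda>v. f (g v)) (x * y) T"
proof
  fix z
  have "tens f x (tens g y T) z
     = (\<Sum>v\<in>Sym d. \<Sum>u\<in>Sym d. pscale (coord (x * gw d h v) z * coord (y * gw d h u) v) (f (g (T u))))"
    by (simp add: tens_def plinear_sum[OF assms] plinear_pscale[OF assms] pscale_sum_right)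
  also have "\<dots> = (\<Sum>u\<in>Sym d. pscale (\<Sum>v\<in>Sym d. coord (y * gw d h u) v * coord (x * gw d h v) z) (f (g (T u))))"
    by (subst sum.swap) (simp add: pscale_sum_left mult.commute)
  also have "\<dots> = tens (\<lambda>v. f (g v)) (x * y) T z"
    by (simp add: tens_def coord_mult_left[symmetric] mult.assoc)
  finally show "tens f x (tens g y T) z = tens (\<lambda>v. f (g v)) (x * y) T z" .
qed

text \<open>Left and right multiplication commute, x (h_u y) = (x h_u) y, read in coordinates. This
  is the source of the right linearity of all operators built from \<open>tens\<close>.\<close>

lemma tens_hmulr:
  assumes "plinear f"
  shows "tens f x (hmulr T y) = hmulr (tens f x T) y"
proof
  fix z
  have "tens f x (hmulr T y) z
     = (\<Sum>v\<in>Sym d. \<Sum>u\<in>Sym d. pscale (coord (x * gw d h v) z * coord (gw d h u * y) v) (f (T u)))"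
    by (simp add: tens_def hmulr_def plinear_sum[OF assms] plinear_pscale[OF assms] pscale_sum_right)
  also have "\<dots> = (\<Sum>u\<in>Sym d. pscale (\<Sum>v\<in>Sym d. coord (gw d h u * y) v * coord (x * gw d h v) z) (f (T u)))"
    by (subst sum.swap) (simp add: pscale_sum_left mult.commute)
  also have "\<dots> = (\<Sum>u\<in>Sym d. pscale (\<Sum>v\<in>Sym d. coord (x * gw d h u) v * coord (gw d h v * y) z) (f (T u)))"
    by (simp add: coord_mult_left[symmetric] coord_mult_right[symmetric] mult.assoc)
  also have "\<dots> = hmulr (tens f x T) y z"
    unfolding tens_def hmulr_def pscale_sum_left pscale_sum_right
    by (subst sum.swap) (simp add: mult.commute)
  finally show "tens f x (hmulr T y) z = hmulr (tens f x T) y z" .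
qed

lemma tens_add_fun: "tens (\<lambda>v. f v + g v) x T = tens f x T + tens g x T"
  by (rule ext) (simp add: tens_def pscale_add_right sum.distrib)

lemma tens_add_elt: "tens f (x + y) T = tens f x T + tens f y T"
  by (rule ext) (simp add: tens_def distrib_right coord_add pscale_add_left sum.distrib)

text \<open>Used from left to right, it collects scalars in the Hecke factor. The \<chi>-terms of
  the relations and those produced by \<open>h_quad\<close> then reach the same normal form.\<close>

lemma tens_pscale_fun: "tens (\<lambda>v. pscale c (f v)) x T = tens f (sH c x) T"
  by (rule ext) (simp add: tens_def Hk_alg[rule_format, THEN conjunct1, symmetric] coord_scale mult.commute)

lemma tens_add: "plinear f \<Longrightarrow> tens f x (T + U) = tens f x T + tens f x U"
  by (rule ext) (simp add: tens_def plinear_add pscale_add_right sum.distrib)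

lemma tens_zero: "plinear f \<Longrightarrow> tens f x 0 = 0"
  by (rule ext) (simp add: tens_def plinear_zero)

lemma hmulr_add: "hmulr (T + U) x = hmulr T x + hmulr U x"
  by (rule ext) (simp add: hmulr_def pscale_add_right sum.distrib)

lemma tens_one:
  assumes "z \<in> Sym d"
  shows "tens f 1 T z = f (T z)"
proof -
  have "tens f 1 T z = (\<Sum>y\<in>Sym d. if y = z then f (T z) else 0)"
    unfolding tens_def by (intro sum.cong) (auto simp: coord_gw)
  then show ?thesis using assms by simp
qed

lemma tens_hpure: "plinear f \<Longrightarrow> tens f x (hpure m) z = pscale (coord x z) (f m)"
  unfolding tens_def hpure_def
  by (subst sum.mono_neutral_right[of "Sym d" "{id}"]) (auto simp: plinear_zero)

lemma hmulr_hpure: "hmulr (hpure m) x z = pscale (coord x z) m"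
  unfolding hmulr_def hpure_def
  by (subst sum.mono_neutral_right[of "Sym d" "{id}"]) auto

text \<open>T is the sum of the T_y \<otimes> h_y, each a right multiple of T_y \<otimes> 1. An
  additive operator commuting with right multiplication is therefore determined by its values on
  elements m \<otimes> 1.\<close>

lemma sum_hmulr_hpure:
  assumes "z \<in> Sym d"
  shows "(\<Sum>y\<in>Sym d. hmulr (hpure (T y)) (gw d h y)) z = T z"
proof -
  have "(\<Sum>y\<in>Sym d. hmulr (hpure (T y)) (gw d h y)) z = (\<Sum>y\<in>Sym d. if y = z then T z else 0)"
    unfolding sum_fun_apply hmulr_hpure by (intro sum.cong) (auto simp: coord_gw)
  then show ?thesis using assms by simp
qed

lemma hsupp_tens: "(\<And>v. tsupp d v \<Longrightarrow> tsupp d (f v)) \<Longrightarrow> hsupp d T \<Longrightarrow> hsupp d (tens f x T)"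
  by (auto simp: hsupp_def tens_def intro!: tsupp_sum tsupp_pscale)

lemma heq_tens_fun:
  "(\<And>v. tsupp d v \<Longrightarrow> teq sc (f v) (g v)) \<Longrightarrow> hsupp d T \<Longrightarrow> heq sc d (tens f x T) (tens g x T)"
  by (auto simp: hsupp_def heq_def tens_def intro!: teq_sum teq_pscale)

lemma heq_tens:
  "(\<And>u v. tsupp d u \<Longrightarrow> tsupp d v \<Longrightarrow> teq sc u v \<Longrightarrow> teq sc (f u) (f v)) \<Longrightarrow>
    hsupp d T \<Longrightarrow> hsupp d U \<Longrightarrow> heq sc d T U \<Longrightarrow> heq sc d (tens f x T) (tens f x U)"
  by (auto simp: hsupp_def heq_def tens_def intro!: teq_sum teq_pscale)

end

section \<open>The operators that the generators of the wreath product must induce\<close>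

locale wreath_module = twisted_hecke d h sH chiS chiR + H: braided d H
  for d :: nat and h :: "nat \<Rightarrow> 'h::ring_1" and sH :: "'k::comm_ring_1 \<Rightarrow> 'h \<Rightarrow> 'h" and chiS chiR :: 'k
    and H :: "nat \<Rightarrow> 'a::ring_1" +
  fixes sB :: "'k \<Rightarrow> 'b::ring_1 \<Rightarrow> 'b"
    and act :: "'b \<Rightarrow> 'm::ab_group_add \<Rightarrow> 'm"
    and S R :: "'b list \<Rightarrow>\<^sub>0 'k"
    and sigma rho :: "('b list \<Rightarrow>\<^sub>0 'k) \<Rightarrow> ('b list \<Rightarrow>\<^sub>0 'k)"
    and iota :: "('b list \<Rightarrow>\<^sub>0 'k) \<Rightarrow> 'a"
    and sM rM :: "('m list \<Rightarrow>\<^sub>0 'k) \<Rightarrow> ('m list \<Rightarrow>\<^sub>0 'k)"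
  assumes B_alg: "\<forall>c x y. sB c (x * y) = sB c x * y \<and> sB c (x * y) = x * sB c y"
    and M_mod: "\<forall>a b m n. act 1 m = m \<and> act (a * b) m = act a (act b m)
                  \<and> act (a + b) m = act a m + act b m \<and> act a (m + n) = act a m + act a n"
    and S2: "tsupp 2 S" and R2: "tsupp 2 R"
    and sigma_lin: "tlin sB 2 sigma" and rho_lin: "tlin sB 2 rho"
    and iota_add: "\<forall>v w. tsupp d v \<longrightarrow> tsupp d w \<longrightarrow> iota (v + w) = iota v + iota w"
    and iota_mult: "\<forall>v w. tsupp d v \<longrightarrow> tsupp d w \<longrightarrow> iota (tact (*) v w) = iota v * iota w"
    and iota_one: "iota (tone d) = 1"
    and H_quad: "\<forall>i\<in>{1..<d}. H i * H i = iota (emb d i S) * H i + iota (emb d i R)"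
    and H_comm_B: "\<forall>i\<in>{1..<d}. \<forall>b. tsupp d b \<longrightarrow>
                     H i * iota b = iota (slot i sigma b) * H i + iota (slot i rho b)"
    and PBW_indep: "\<forall>c c'. (\<forall>w\<in>Sym d. tsupp d (c w) \<and> tsupp d (c' w)) \<longrightarrow>
                     (\<Sum>w\<in>Sym d. iota (c w) * gw d H w) = (\<Sum>w\<in>Sym d. iota (c' w) * gw d H w) \<longrightarrow>
                     (\<forall>w\<in>Sym d. teq sB (c w) (c' w))"
    and sM_lin: "tlin (\<lambda>c. act (sB c 1)) 2 sM" and rM_lin: "tlin (\<lambda>c. act (sB c 1)) 2 rM"
begin

abbreviation scM :: "'k \<Rightarrow> 'm \<Rightarrow> 'm" where
  "scM \<equiv> \<lambda>c. act (sB c 1)"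

abbreviation sl :: "nat \<Rightarrow> ('m list \<Rightarrow>\<^sub>0 'k) \<Rightarrow> ('m list \<Rightarrow>\<^sub>0 'k)" where
  "sl i \<equiv> slot i sM"

abbreviation rl :: "nat \<Rightarrow> ('m list \<Rightarrow>\<^sub>0 'k) \<Rightarrow> ('m list \<Rightarrow>\<^sub>0 'k)" where
  "rl i \<equiv> slot i rM"

abbreviation tac :: "('b list \<Rightarrow>\<^sub>0 'k) \<Rightarrow> ('m list \<Rightarrow>\<^sub>0 'k) \<Rightarrow> ('m list \<Rightarrow>\<^sub>0 'k)" where
  "tac \<equiv> tact act"

lemma act_simps: "act 1 m = m" "act (a * b) m = act a (act b m)"
  "act (a + b) m = act a m + act b m" "act a (m + n) = act a m + act a n"
  using M_mod by blast+

text \<open>\<open>sB c 1\<close> is central in B by \<open>B_alg\<close>, so the K-structure that M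
  inherits from B commutes with the action of B. This is the scalar condition of
  \<open>tact_trel_left\<close> and \<open>tact_trel_right\<close>.\<close>

lemma act_sB: "act (sB c a) m = scM c (act a m)" "act a (scM c m) = scM c (act a m)"
proof -
  have "sB c a = sB c 1 * a" "a * sB c 1 = sB c 1 * a"
    using B_alg by (metis mult_1 mult_1_right)+
  then show "act (sB c a) m = scM c (act a m)" "act a (scM c m) = scM c (act a m)"
    by (metis act_simps(2))+
qed

lemma tac_teq_right:
  assumes "tsupp d X" "tsupp d u" "tsupp d v" "teq scM u v"
  shows "teq scM (tac X u) (tac X v)"
proof -
  have "tsupp d (u - v)"
    using tsupp_add[OF assms(2) tsupp_pscale[OF assms(3), of "-1"]] by (simp add: pscale_uminus_one)
  from tact_trel_right[where sc = scM and act = act, OF assms(1) assms(4)[unfolded teq_def] this act_simps(4) act_sB(2)]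
  have "tac X (u - v) \<in> trel scM" .
  then show ?thesis by (simp add: teq_def plinear_diff[OF plinear_tact])
qed

lemma tac_teq_left:
  assumes "tsupp d u" "tsupp d X" "tsupp d Y" "teq sB X Y"
  shows "teq scM (tac X u) (tac Y u)"
proof -
  have "tsupp d (X - Y)"
    using tsupp_add[OF assms(2) tsupp_pscale[OF assms(3), of "-1"]] by (simp add: pscale_uminus_one)
  from tact_trel_left[where sc = scM and act = act and sc' = sB, OF assms(1) assms(4)[unfolded teq_def] this act_simps(3) act_sB(1)]
  have "tac (X - Y) u \<in> trel scM" .
  then show ?thesis by (simp add: teq_def plinear_diff[OF plinear_tact_left])
qed

lemma slot_teq:
  assumes f: "tlin scM 2 f" and i: "i \<in> {1..<d}" and uv: "tsupp d u" "tsupp d v" "teq scM u v"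
  shows "teq scM (slot i f u) (slot i f v)"
proof -
  have "tsupp d (u - v)"
    using tsupp_add[OF uv(1) tsupp_pscale[OF uv(2), of "-1"]] by (simp add: pscale_uminus_one)
  then have "slot i f (u - v) \<in> trel scM"
    using slot_trel[OF f, of i d "u - v"] uv(3) i by (simp add: teq_def)
  then show ?thesis by (simp add: teq_def plinear_diff[OF plinear_slot])
qed

lemmas sl_teq = slot_teq[OF sM_lin] and rl_teq = slot_teq[OF rM_lin]

lemma tsupp_sl: "i \<in> {1..<d} \<Longrightarrow> tsupp d v \<Longrightarrow> tsupp d (sl i v)"
  and tsupp_rl: "i \<in> {1..<d} \<Longrightarrow> tsupp d v \<Longrightarrow> tsupp d (rl i v)"
  using tsupp_slot[OF sM_lin, of i d v] tsupp_slot[OF rM_lin, of i d v] by auto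

lemma tsupp_sigma: "i \<in> {1..<d} \<Longrightarrow> tsupp d b \<Longrightarrow> tsupp d (slot i sigma b)"
  and tsupp_rho: "i \<in> {1..<d} \<Longrightarrow> tsupp d b \<Longrightarrow> tsupp d (slot i rho b)"
  using tsupp_slot[OF sigma_lin, of i d b] tsupp_slot[OF rho_lin, of i d b] by auto

lemma tsupp_embS: "i \<in> {1..<d} \<Longrightarrow> tsupp d (emb d i S)"
  and tsupp_embR: "i \<in> {1..<d} \<Longrightarrow> tsupp d (emb d i R)"
  by (auto intro: tsupp_emb S2 R2)

text \<open>The operator by which \<open>H\<^sub>i\<close> has to act on M \<otimes> H~, and below it that of b.\<close>
definition gop :: "nat \<Rightarrow> ('m, 'k) mh \<Rightarrow> ('m, 'k) mh" where
  "gop i T = tens (sl i) (h i) T + tens (rl i) 1 T"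

definition bop :: "('b list \<Rightarrow>\<^sub>0 'k) \<Rightarrow> ('m, 'k) mh \<Rightarrow> ('m, 'k) mh" where
  "bop b = tens (tac b) 1"

definition gopw :: "nat list \<Rightarrow> ('m, 'k) mh \<Rightarrow> ('m, 'k) mh" where
  "gopw ws T = foldr gop ws T"

lemma gopw_simps [simp]: "gopw [] T = T" "gopw (i # ws) T = gop i (gopw ws T)"
  by (simp_all add: gopw_def)

lemma gopw_append: "gopw (u @ v) T = gopw u (gopw v T)"
  by (simp add: gopw_def)

lemma gop_add: "gop i (T + U) = gop i T + gop i U"
  by (simp add: gop_def tens_add plinear_slot add_ac)

lemma gop_zero: "gop i 0 = 0"
  by (simp add: gop_def tens_zero plinear_slot)

lemma gop_sum: "gop i (sum f A) = (\<Sum>a\<in>A. gop i (f a))"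
  by (induction A rule: infinite_finite_induct) (simp_all add: gop_add gop_zero del: plus_fun_apply zero_fun_apply)

lemma gopw_sum: "gopw ws (sum f A) = (\<Sum>a\<in>A. gopw ws (f a))"
  by (induction ws) (simp_all add: gop_sum)

lemma gop_hmulr: "gop i (hmulr T x) = hmulr (gop i T) x"
  by (simp add: gop_def tens_hmulr plinear_slot hmulr_add)

lemma gopw_hmulr: "gopw ws (hmulr T x) = hmulr (gopw ws T) x"
  by (induction ws) (simp_all add: gop_hmulr)

lemma bop_add: "bop b (T + U) = bop b T + bop b U"
  by (simp add: bop_def tens_add plinear_tact)

lemma bop_zero: "bop b 0 = 0"
  by (simp add: bop_def tens_zero plinear_tact)

lemma bop_sum: "bop b (sum f A) = (\<Sum>a\<in>A. bop b (f a))"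
  by (induction A rule: infinite_finite_induct) (simp_all add: bop_add bop_zero del: plus_fun_apply zero_fun_apply)

lemma bop_apply: "z \<in> Sym d \<Longrightarrow> bop b T z = tac b (T z)"
  by (simp add: bop_def tens_one)

lemma hsupp_gop: "i \<in> {1..<d} \<Longrightarrow> hsupp d T \<Longrightarrow> hsupp d (gop i T)"
  by (simp add: gop_def hsupp_add hsupp_tens tsupp_sl tsupp_rl)

lemma hsupp_gopw: "set ws \<subseteq> {1..<d} \<Longrightarrow> hsupp d T \<Longrightarrow> hsupp d (gopw ws T)"
  by (induction ws) (simp_all add: hsupp_gop)

lemma hsupp_bop: "tsupp d b \<Longrightarrow> hsupp d T \<Longrightarrow> hsupp d (bop b T)"
  by (simp add: bop_def hsupp_tens tsupp_tact)

lemma heq_gop: "i \<in> {1..<d} \<Longrightarrow> hsupp d T \<Longrightarrow> hsupp d U \<Longrightarrow> heq scM d T U \<Longrightarrow> heq scM d (gop i T) (gop i U)"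
  unfolding gop_def by (intro heq_add heq_tens sl_teq rl_teq)

lemma heq_gopw:
  "set ws \<subseteq> {1..<d} \<Longrightarrow> hsupp d T \<Longrightarrow> hsupp d U \<Longrightarrow> heq scM d T U \<Longrightarrow> heq scM d (gopw ws T) (gopw ws U)"
  by (induction ws) (simp_all add: heq_gop hsupp_gopw)

lemma heq_bop: "tsupp d b \<Longrightarrow> hsupp d T \<Longrightarrow> hsupp d U \<Longrightarrow> heq scM d T U \<Longrightarrow> heq scM d (bop b T) (bop b U)"
  unfolding bop_def by (intro heq_tens tac_teq_right)

text \<open>\<open>tau_word\<close> uses the unnormalised \<open>hcoord\<close> and may differ from
  \<open>gopw\<close> outside \<open>Sym d\<close>; since \<open>gop\<close> reads its argument only
  on \<open>Sym d\<close>, the difference does not propagate.\<close>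

lemma gop_agree: "(\<And>y. y \<in> Sym d \<Longrightarrow> T y = U y) \<Longrightarrow> gop i T = gop i U"
  unfolding gop_def by (metis tens_agree)

lemma gopw_agree: "(\<And>y. y \<in> Sym d \<Longrightarrow> T y = U y) \<Longrightarrow> z \<in> Sym d \<Longrightarrow> gopw ws T z = gopw ws U z"
proof (induction ws arbitrary: z)
  case (Cons i ws)
  have "gop i (gopw ws T) = gop i (gopw ws U)"
    by (rule gop_agree) (rule Cons.IH[OF Cons.prems(1)])
  then show ?case by simp
qed simp

lemma tau_word_eq: "z \<in> Sym d \<Longrightarrow> tau_word sH h d sM rM ws m z = gopw ws (hpure m) z"
proof (induction ws arbitrary: z)
  case Nil
  then show ?case by (simp add: hpure_def)
next
  case (Cons i ws)
  let ?T = "tau_word sH h d sM rM ws m"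
  have "tau_word sH h d sM rM (i # ws) m z = gop i ?T z"
    using Cons.prems
    by (simp add: Let_def gop_def tens_one sum.distrib) (simp add: tens_def coord_def)
  also have "gop i ?T = gop i (gopw ws (hpure m))"
    by (rule gop_agree) (rule Cons.IH)
  finally show ?case by simp
qed

lemmas tens_expand = tens_comp tens_add tens_add_fun tens_add_elt tens_pscale_fun plinear_slot plinear_tact

text \<open>Of the four products only \<sigma>\<sigma> \<otimes> h_i^2 is not yet expanded in the
  basis; \<open>h_quad\<close> spreads it over h_i and 1, which explains the two scalar terms of
  (M4).\<close>

lemma gop_gop_same:
  assumes "i \<in> {1..<d}"
  shows "gop i (gop i T)
    = tens (\<lambda>v. pscale chiS (sl i (sl i v)) + rl i (sl i v) + sl i (rl i v)) (h i) T
    + tens (\<lambda>v. pscale chiR (sl i (sl i v)) + rl i (rl i v)) 1 T"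
  using h_quad[rule_format, OF assms] by (simp add: gop_def tens_expand add_ac)

lemma bop_gop: "bop b (gop i T) = tens (\<lambda>v. tac b (sl i v)) (h i) T + tens (\<lambda>v. tac b (rl i v)) 1 T"
  by (simp add: gop_def bop_def tens_expand add_ac)

lemma gop_bop: "gop i (bop b T) = tens (\<lambda>v. sl i (tac b v)) (h i) T + tens (\<lambda>v. rl i (tac b v)) 1 T"
  by (simp add: gop_def bop_def tens_expand add_ac)

lemma gop_gop: "gop i (gop j T) = tens (\<lambda>v. sl i (sl j v)) (h i * h j) T + tens (\<lambda>v. sl i (rl j v)) (h i) T
   + tens (\<lambda>v. rl i (sl j v)) (h j) T + tens (\<lambda>v. rl i (rl j v)) 1 T"
  by (simp add: gop_def tens_expand add_ac)

text \<open>Eight products, of which \<sigma>\<rho>\<sigma> carries h_i^2 and is split by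
  \<open>h_quad\<close> between h_i and 1. These two pieces are the scalar terms of (M6) and
  (M7).\<close>

lemma gop_gop_gop:
  assumes "i \<in> {1..<d}"
  shows "gop i (gop j (gop i T))
    = tens (\<lambda>v. sl i (sl j (sl i v))) (h i * (h j * h i)) T
    + tens (\<lambda>v. sl i (sl j (rl i v))) (h i * h j) T
    + tens (\<lambda>v. rl i (sl j (sl i v))) (h j * h i) T
    + tens (\<lambda>v. pscale chiS (sl i (rl j (sl i v))) + rl i (rl j (sl i v)) + sl i (rl j (rl i v))) (h i) T
    + tens (\<lambda>v. rl i (sl j (rl i v))) (h j) T
    + tens (\<lambda>v. rl i (rl j (rl i v)) + pscale chiR (sl i (rl j (sl i v)))) 1 T"
  using h_quad[rule_format, OF assms] by (simp add: gop_def tens_expand add_ac)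

subsection \<open>The relations imply the ground module axioms\<close>

text \<open>Recognises the right-hand side of the second multiplication axiom as a composite of
  operators at m \<otimes> 1: the factors h_y are pulled inside \<open>gopw u\<close> by right
  linearity, where the sum reassembles \<open>gopw v (hpure m)\<close>.\<close>

lemma tau_compose:
  assumes z: "z \<in> Sym d"
  shows "(\<Sum>y\<in>Sym d. hright sH h d (tau_word sH h d sM rM u (tau_word sH h d sM rM v m y)) (gw d h y) z)
       = gopw u (gopw v (hpure m)) z"
proof -
  let ?T = "gopw v (hpure m)"
  have "hright sH h d (tau_word sH h d sM rM u (tau_word sH h d sM rM v m y)) (gw d h y) z
      = gopw u (hmulr (hpure (?T y)) (gw d h y)) z" if y: "y \<in> Sym d" for y
    unfolding gopw_hmulr using z y by (simp add: hmulr_hright hright_def tau_word_eq)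
  then have "(\<Sum>y\<in>Sym d. hright sH h d (tau_word sH h d sM rM u (tau_word sH h d sM rM v m y)) (gw d h y) z)
      = gopw u (\<Sum>y\<in>Sym d. hmulr (hpure (?T y)) (gw d h y)) z"
    by (simp add: gopw_sum sum_fun_apply)
  also have "\<dots> = gopw u ?T z"
    by (rule gopw_agree[OF _ z]) (rule sum_hmulr_hpure)
  finally show ?thesis .
qed

lemma iota_zero [simp]: "iota 0 = 0"
  using iota_add[rule_format, of 0 0] by simp

end

locale ground_relations = wreath_module d h sH chiS chiR H sB act S R sigma rho iota sM rM
  for d h and sH :: "'k::comm_ring_1 \<Rightarrow> 'h::ring_1 \<Rightarrow> 'h" and chiS chiR
    and H :: "nat \<Rightarrow> 'a::ring_1" and sB :: "'k \<Rightarrow> 'b::ring_1 \<Rightarrow> 'b"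
    and act :: "'b \<Rightarrow> 'm::ab_group_add \<Rightarrow> 'm" and S R sigma rho iota sM rM +
  assumes M2s: "i \<in> {1..<d} \<Longrightarrow> tsupp d b \<Longrightarrow> tsupp d m \<Longrightarrow>
      teq scM (sl i (tac b m)) (tac (slot i sigma b) (sl i m))"
    and M2r: "i \<in> {1..<d} \<Longrightarrow> tsupp d b \<Longrightarrow> tsupp d m \<Longrightarrow>
      teq scM (rl i (tac b m)) (tac (slot i sigma b) (rl i m) + tac (slot i rho b) m)"
    and M4s: "i \<in> {1..<d} \<Longrightarrow> tsupp d m \<Longrightarrow>
      teq scM (pscale chiS (sl i (sl i m)) + rl i (sl i m) + sl i (rl i m)) (tac (emb d i S) (sl i m))"
    and M4r: "i \<in> {1..<d} \<Longrightarrow> tsupp d m \<Longrightarrow>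
      teq scM (pscale chiR (sl i (sl i m)) + rl i (rl i m)) (tac (emb d i S) (rl i m) + tac (emb d i R) m)"
    and M5s: "i \<in> {1..<d} \<Longrightarrow> j \<in> {1..<d} \<Longrightarrow> j = i + 1 \<or> i = j + 1 \<Longrightarrow> tsupp d m \<Longrightarrow>
      teq scM (sl i (sl j (sl i m))) (sl j (sl i (sl j m)))"
    and M5r: "i \<in> {1..<d} \<Longrightarrow> j \<in> {1..<d} \<Longrightarrow> j = i + 1 \<or> i = j + 1 \<Longrightarrow> tsupp d m \<Longrightarrow>
      teq scM (rl i (sl j (sl i m))) (sl j (sl i (rl j m)))"
    and M6: "i \<in> {1..<d} \<Longrightarrow> j \<in> {1..<d} \<Longrightarrow> j = i + 1 \<or> i = j + 1 \<Longrightarrow> tsupp d m \<Longrightarrow>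
      teq scM (rl i (sl j (rl i m)))
        (pscale chiS (sl j (rl i (sl j m))) + rl j (rl i (sl j m)) + sl j (rl i (rl j m)))"
    and M7: "i \<in> {1..<d} \<Longrightarrow> j \<in> {1..<d} \<Longrightarrow> j = i + 1 \<or> i = j + 1 \<Longrightarrow> tsupp d m \<Longrightarrow>
      teq scM (rl i (rl j (rl i m)) + pscale chiR (sl i (rl j (sl i m))))
        (rl j (rl i (rl j m)) + pscale chiR (sl j (rl i (sl j m))))"
begin

lemma gop_bop_heq:
  assumes i: "i \<in> {1..<d}" and b: "tsupp d b" and T: "hsupp d T"
  shows "heq scM d (gop i (bop b T)) (bop (slot i sigma b) (gop i T) + bop (slot i rho b) T)"
proof -
  have "heq scM d (gop i (bop b T))
      (tens (\<lambda>v. tac (slot i sigma b) (sl i v)) (h i) T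
       + tens (\<lambda>v. tac (slot i sigma b) (rl i v) + tac (slot i rho b) v) 1 T)"
    unfolding gop_bop by (intro heq_add heq_tens_fun M2s[OF i b] M2r[OF i b] T)
  then show ?thesis by (simp add: bop_gop tens_add_fun bop_def[of "slot i rho b"] add.assoc)
qed

lemma gop_quad_heq:
  assumes i: "i \<in> {1..<d}" and T: "hsupp d T"
  shows "heq scM d (gop i (gop i T)) (bop (emb d i S) (gop i T) + bop (emb d i R) T)"
proof -
  have "heq scM d (gop i (gop i T))
      (tens (\<lambda>v. tac (emb d i S) (sl i v)) (h i) T
       + tens (\<lambda>v. tac (emb d i S) (rl i v) + tac (emb d i R) v) 1 T)"
    unfolding gop_gop_same[OF i] by (intro heq_add heq_tens_fun M4s[OF i] M4r[OF i] T)
  then show ?thesis by (simp add: bop_gop tens_add_fun bop_def[of "emb d i R"] add.assoc)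
qed

text \<open>The coefficients at h_i h_{i+1} and at h_i are the second equation of (M5) and (M6) for
  the exchanged pair, read backwards; the other four come from the pair (i, i + 1) itself.\<close>

lemma gop_braid_heq:
  assumes i: "i \<in> {1..<d}" and j: "Suc i \<in> {1..<d}" and T: "hsupp d T"
  shows "heq scM d (gop i (gop (Suc i) (gop i T))) (gop (Suc i) (gop i (gop (Suc i) T)))"
proof -
  let ?j = "Suc i"
  have ij: "?j = i + 1 \<or> i = ?j + 1" "i = ?j + 1 \<or> ?j = i + 1" by simp_all
  have hb: "h i * (h ?j * h i) = h ?j * (h i * h ?j)"
    using braid_rel[rule_format, of i] i j by (simp add: mult.assoc)
  have "heq scM d (gop i (gop ?j (gop i T)))
     (tens (\<lambda>v. sl ?j (sl i (sl ?j v))) (h i * (h ?j * h i)) T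
    + tens (\<lambda>v. rl ?j (sl i (sl ?j v))) (h i * h ?j) T
    + tens (\<lambda>v. sl ?j (sl i (rl ?j v))) (h ?j * h i) T
    + tens (\<lambda>v. rl ?j (sl i (rl ?j v))) (h i) T
    + tens (\<lambda>v. pscale chiS (sl ?j (rl i (sl ?j v))) + rl ?j (rl i (sl ?j v)) + sl ?j (rl i (rl ?j v))) (h ?j) T
    + tens (\<lambda>v. rl ?j (rl i (rl ?j v)) + pscale chiR (sl ?j (rl i (sl ?j v)))) 1 T)"
    unfolding gop_gop_gop[OF i]
    by (intro heq_add heq_tens_fun T M5s[OF i j ij(1)] M5r[OF i j ij(1)] M6[OF i j ij(1)] M7[OF i j ij(1)]
        teq_sym[OF M5r[OF j i ij(2)]] teq_sym[OF M6[OF j i ij(2)]])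
  then show ?thesis unfolding gop_gop_gop[OF j] hb by (simp add: add_ac)
qed

lemma gop_commute_heq:
  assumes i: "i \<in> {1..<d}" and j: "j \<in> {1..<d}" and ij: "i + 2 \<le> j" and T: "hsupp d T"
  shows "heq scM d (gop i (gop j T)) (gop j (gop i T))"
proof -
  have hc: "h i * h j = h j * h i" using comm_rel i j ij by blast
  have sc: "teq scM (slot i f (slot j g v)) (slot j g (slot i f v))"
    if "tlin scM 2 f" "tlin scM 2 g" "tsupp d v" for f g v
    using slot_commute[OF that(1,2) _ ij _ that(3)] i j by simp
  have "heq scM d (gop i (gop j T))
     (tens (\<lambda>v. sl j (sl i v)) (h i * h j) T + tens (\<lambda>v. rl j (sl i v)) (h i) T
      + tens (\<lambda>v. sl j (rl i v)) (h j) T + tens (\<lambda>v. rl j (rl i v)) 1 T)"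
    unfolding gop_gop by (intro heq_add heq_tens_fun T sc sM_lin rM_lin)
  then show ?thesis unfolding gop_gop hc by (simp add: add_ac)
qed

lemma gopw_braid_eq:
  "braid_eq u v \<Longrightarrow> set u \<subseteq> {1..<d} \<Longrightarrow> hsupp d T \<Longrightarrow> heq scM d (gopw u T) (gopw v T)"
proof (induction rule: braid_eq.induct)
  case (sym u v)
  show ?case by (rule heq_sym, rule sym.IH) (use sym.prems braid_eq_set[OF sym.hyps] in simp_all)
next
  case (trans u v w)
  show ?case
    by (rule heq_trans[OF trans.IH]) (use trans.prems braid_eq_set[OF trans.hyps(1)] in simp_all)
next
  case (comm i j a b)
  then have "heq scM d (gopw [i, j] (gopw b T)) (gopw [j, i] (gopw b T))"
    by (simp add: gop_commute_heq hsupp_gopw)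
  then show ?case using comm unfolding gopw_append
    by (intro heq_gopw hsupp_gopw) simp_all
next
  case (braid a i b)
  then have "heq scM d (gopw [i, Suc i, i] (gopw b T)) (gopw [Suc i, i, Suc i] (gopw b T))"
    by (simp add: gop_braid_heq hsupp_gopw)
  then show ?case using braid unfolding gopw_append
    by (intro heq_gopw hsupp_gopw) simp_all
qed simp

lemma gopw_reduced:
  assumes "reduced_expr d u w" "reduced_expr d v w" "hsupp d T"
  shows "heq scM d (gopw u T) (gopw v T)"
  using gopw_braid_eq[OF reduced_expr_braid_eq[OF assms(1,2)]] assms by (simp add: reduced_expr_def)

section \<open>Letting algebra elements act through their PBW coordinates\<close>

definition perm_op :: "(nat \<Rightarrow> nat) \<Rightarrow> ('m, 'k) mh \<Rightarrow> ('m, 'k) mh" where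
  "perm_op w = gopw (rexp d w)"

lemma hsupp_perm_op: "w \<in> Sym d \<Longrightarrow> hsupp d T \<Longrightarrow> hsupp d (perm_op w T)"
  using reduced_expr_rexp[of w d] by (simp add: perm_op_def hsupp_gopw reduced_expr_def)

lemma perm_op_up:
  assumes "w \<in> Sym d" "i \<in> {1..<d}" "inv w i < inv w (Suc i)" "hsupp d T"
  shows "heq scM d (gop i (perm_op w T)) (perm_op (sref i \<circ> w) T)"
proof -
  have "reduced_expr d (i # rexp d w) (sref i \<circ> w)"
    using assms inv_sref_comp[OF assms(1), of i] reduced_expr_rexp[OF assms(1)]
    by (simp add: reduced_expr_Cons sref_apply)
  from gopw_reduced[OF this reduced_expr_rexp assms(4)] assms(1,2) show ?thesis
    by (simp add: perm_op_def)
qed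

text \<open>Operator counterpart of \<open>pbw c\<close> below: the same coordinate family, with
  each basis element replaced by the operator it should induce.\<close>

definition lift_act :: "((nat \<Rightarrow> nat) \<Rightarrow> ('b list \<Rightarrow>\<^sub>0 'k)) \<Rightarrow> ('m, 'k) mh \<Rightarrow> ('m, 'k) mh" where
  "lift_act c T = (\<Sum>g\<in>Sym d. bop (c g) (perm_op g T))"

definition pbw :: "((nat \<Rightarrow> nat) \<Rightarrow> ('b list \<Rightarrow>\<^sub>0 'k)) \<Rightarrow> 'a" where
  "pbw c = (\<Sum>g\<in>Sym d. iota (c g) * gw d H g)"

text \<open>An element acts through its PBW coordinates, so multiplicativity is not automatic.\<close>
definition acts :: "'a \<Rightarrow> (('m, 'k) mh \<Rightarrow> ('m, 'k) mh) \<Rightarrow> bool" where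
  "acts a P \<longleftrightarrow> (\<exists>c. (\<forall>g\<in>Sym d. tsupp d (c g)) \<and> a = pbw c \<and>
     (\<forall>T. hsupp d T \<longrightarrow> hsupp d (P T) \<and> heq scM d (P T) (lift_act c T)))"

lemma hsupp_lift_act: "(\<And>g. g \<in> Sym d \<Longrightarrow> tsupp d (c g)) \<Longrightarrow> hsupp d T \<Longrightarrow> hsupp d (lift_act c T)"
  unfolding lift_act_def by (intro hsupp_sum hsupp_bop hsupp_perm_op)

text \<open>The axioms speak of arbitrary coordinate families, while \<open>acts\<close> provides
  one. By \<open>PBW_indep\<close> two families agree up to \<open>teq sB\<close>, and
  \<open>tac_teq_left\<close> turns this into equality in the tensor power of M.\<close>

lemma acts_unique:
  assumes "acts a P" and c: "\<And>g. g \<in> Sym d \<Longrightarrow> tsupp d (c g)" and a: "a = pbw c" and T: "hsupp d T"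
  shows "heq scM d (P T) (lift_act c T)"
proof -
  obtain c' where c': "\<forall>g\<in>Sym d. tsupp d (c' g)" "a = pbw c'" "heq scM d (P T) (lift_act c' T)"
    using assms unfolding acts_def by blast
  have "teq sB (c' g) (c g)" if "g \<in> Sym d" for g
    using PBW_indep[rule_format, of c' c g] c c'(1,2) a that by (simp add: pbw_def)
  then have "heq scM d (lift_act c' T) (lift_act c T)"
    unfolding lift_act_def bop_def
    by (intro heq_sum heq_tens_fun tac_teq_left hsupp_perm_op T c) (use c' in auto)
  with c'(3) show ?thesis by (rule heq_trans)
qed

lemma acts_cong:
  assumes "acts a P" and "\<And>T. hsupp d T \<Longrightarrow> hsupp d (Q T)" "\<And>T. hsupp d T \<Longrightarrow> heq scM d (Q T) (P T)"
  shows "acts a Q"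
proof -
  obtain c where c: "\<forall>g\<in>Sym d. tsupp d (c g)" "a = pbw c"
      "\<And>T. hsupp d T \<Longrightarrow> heq scM d (P T) (lift_act c T)"
    using assms(1) unfolding acts_def by blast
  then have "heq scM d (Q T) (lift_act c T)" if "hsupp d T" for T
    using heq_trans[OF assms(3)] that by blast
  with c(1,2) assms(2) show ?thesis unfolding acts_def by blast
qed

lemma acts_zero: "acts 0 (\<lambda>T. 0)"
proof -
  have "lift_act (\<lambda>g. 0) T = 0" for T
    unfolding lift_act_def bop_def tens_def tact_def by (auto simp: plin_def sum_fun_apply)
  then show ?thesis
    unfolding acts_def by (intro exI[of _ "\<lambda>g. 0"]) (auto simp: pbw_def hsupp_def)
qed

lemma acts_add:
  assumes "acts a P" "acts b Q"
  shows "acts (a + b) (\<lambda>T. P T + Q T)"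
proof -
  obtain c c' where c: "\<forall>g\<in>Sym d. tsupp d (c g)" "a = pbw c"
      "\<And>T. hsupp d T \<Longrightarrow> hsupp d (P T) \<and> heq scM d (P T) (lift_act c T)"
    and c': "\<forall>g\<in>Sym d. tsupp d (c' g)" "b = pbw c'"
      "\<And>T. hsupp d T \<Longrightarrow> hsupp d (Q T) \<and> heq scM d (Q T) (lift_act c' T)"
    using assms unfolding acts_def by blast
  have "bop (c g + c' g) T = bop (c g) T + bop (c' g) T" for g T
    unfolding bop_def plinear_add[OF plinear_tact_left] tens_add_fun ..
  then have "lift_act (\<lambda>g. c g + c' g) T = lift_act c T + lift_act c' T" for T
    unfolding lift_act_def by (simp only: sum.distrib)
  moreover have "pbw (\<lambda>g. c g + c' g) = a + b"
    using c(1) c'(1) by (simp add: c(2) c'(2) pbw_def iota_add distrib_right sum.distrib)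
  ultimately show ?thesis
    using c c' unfolding acts_def
    by (intro exI[of _ "\<lambda>g. c g + c' g"]) (simp add: tsupp_add hsupp_add heq_add del: plus_fun_apply)
qed

lemma acts_sum:
  "(\<And>g. g \<in> A \<Longrightarrow> acts (f g) (F g)) \<Longrightarrow> acts (\<Sum>g\<in>A. f g) (\<lambda>T. \<Sum>g\<in>A. F g T)"
  by (induction A rule: infinite_finite_induct)
    (simp_all add: acts_zero acts_add del: zero_fun_apply plus_fun_apply)

lemma bop_mult: "bop (tact (*) b c) T = bop b (bop c T)"
proof -
  have "tac (tact (*) b c) = (\<lambda>v. tac b (tac c v))"
    by (rule ext) (rule tact_assoc, rule act_simps(2))
  then show ?thesis by (simp add: bop_def tens_comp plinear_tact)
qed

lemma acts_iota_mult:
  assumes "acts a P" and b: "tsupp d b"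
  shows "acts (iota b * a) (\<lambda>T. bop b (P T))"
proof -
  obtain c where c: "\<forall>g\<in>Sym d. tsupp d (c g)" "a = pbw c"
      "\<And>T. hsupp d T \<Longrightarrow> hsupp d (P T) \<and> heq scM d (P T) (lift_act c T)"
    using assms unfolding acts_def by blast
  have "lift_act (\<lambda>g. tact (*) b (c g)) T = bop b (lift_act c T)" for T
    by (simp add: lift_act_def bop_sum bop_mult)
  moreover have "iota b * a = pbw (\<lambda>g. tact (*) b (c g))"
    using c(1) b by (simp add: c(2) pbw_def iota_mult sum_distrib_left mult.assoc)
  ultimately show ?thesis
    using c b unfolding acts_def
    by (intro exI[of _ "\<lambda>g. tact (*) b (c g)"]) (simp add: tsupp_tact hsupp_bop heq_bop hsupp_lift_act)
qed

lemma acts_gw: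
  assumes w: "w \<in> Sym d"
  shows "acts (gw d H w) (perm_op w)"
proof -
  let ?c = "\<lambda>g. if g = w then tone d else 0"
  have "gw d H w = pbw ?c"
    unfolding pbw_def using w
    by (subst sum.mono_neutral_right[of "Sym d" "{w}"]) (auto simp: iota_one)
  moreover have "lift_act ?c T z = perm_op w T z" if T: "hsupp d T" and z: "z \<in> Sym d" for T z
  proof -
    have tac_tone: "tac (tone d) (perm_op w T z) = perm_op w T z"
      using hsupp_perm_op[OF w T] z by (intro tact_tone act_simps) (simp add: hsupp_def)
    have "lift_act ?c T z = (\<Sum>g\<in>Sym d. if g = w then perm_op w T z else 0)"
      unfolding lift_act_def sum_fun_apply
      by (intro sum.cong)
        (auto simp: bop_apply[OF z] plinear_zero[OF plinear_tact_left] tac_tone)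
    then show ?thesis using w by simp
  qed
  ultimately show ?thesis unfolding acts_def
    by (intro exI[of _ ?c]) (auto intro: hsupp_perm_op w heq_agree)
qed

text \<open>At an ascent, H_i H_g is again a basis element and Matsumoto's theorem identifies the
  operators. At a descent, H_g = H_i H_{g'} with g' = s_i g, so H_i H_g = S_i H_g + R_i H_{g'};
  \<open>gop_quad_heq\<close> is the same computation for the operators.\<close>

lemma acts_gen_gw:
  assumes g: "g \<in> Sym d" and i: "i \<in> {1..<d}"
  shows "acts (H i * gw d H g) (\<lambda>T. gop i (perm_op g T))"
  using g i
proof (cases rule: perm_len_sref_cases)
  case 1
  have "acts (H i * gw d H g) (perm_op (sref i \<circ> g))"
    using acts_gw[OF sref_comp_Sym[OF i g]] unfolding H.gw_up[OF g i 1(1)] .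
  then show ?thesis
    by (rule acts_cong) (intro hsupp_gop hsupp_perm_op perm_op_up g i 1(1), assumption)+
next
  case 2
  let ?g = "sref i \<circ> g"
  note g' = sref_comp_Sym[OF i g]
  have up: "inv ?g i < inv ?g (Suc i)"
    using 2 inv_sref_comp[OF g, of i] by (simp add: sref_apply)
  have gw: "gw d H g = H i * gw d H ?g" by (rule H.gw_down[OF g i 2(1)])
  have mult: "H i * gw d H g = iota (emb d i S) * gw d H g + iota (emb d i R) * gw d H ?g"
    using H_quad[rule_format, OF i] unfolding gw
    by (simp add: mult.assoc[symmetric] distrib_right)
  have down: "heq scM d (perm_op g T) (gop i (perm_op ?g T))" if "hsupp d T" for T
    using perm_op_up[OF g' i up that] by (simp add: heq_sym)
  have "acts (H i * gw d H g) (\<lambda>T. bop (emb d i S) (perm_op g T) + bop (emb d i R) (perm_op ?g T))"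
    unfolding mult by (intro acts_add acts_iota_mult acts_gw g g' tsupp_embS tsupp_embR i)
  then show ?thesis
  proof (rule acts_cong)
    fix T :: "('m, 'k) mh" assume T: "hsupp d T"
    note sg = hsupp_perm_op[OF g T] and sg' = hsupp_perm_op[OF g' T]
    show "hsupp d (gop i (perm_op g T))" by (rule hsupp_gop[OF i sg])
    have "heq scM d (gop i (perm_op g T)) (gop i (gop i (perm_op ?g T)))"
      by (intro heq_gop i sg hsupp_gop sg' down T)
    also have "heq scM d \<dots> (bop (emb d i S) (gop i (perm_op ?g T)) + bop (emb d i R) (perm_op ?g T))"
      by (rule gop_quad_heq[OF i sg'])
    also have "heq scM d \<dots> (bop (emb d i S) (perm_op g T) + bop (emb d i R) (perm_op ?g T))"
      by (intro heq_add heq_refl heq_bop heq_sym[OF down] tsupp_embS hsupp_gop i sg sg' T)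
    finally show "heq scM d (gop i (perm_op g T))
        (bop (emb d i S) (perm_op g T) + bop (emb d i R) (perm_op ?g T))" .
  qed
qed

text \<open>To reach the basis elements, H_i has to pass the coefficients: \<open>H_comm_B\<close>
  does this in the algebra and \<open>gop_bop_heq\<close>, that is (M2), for the operators, with the
  same \<sigma>- and \<rho>-terms.\<close>

lemma acts_gen_mult:
  assumes "acts a P" and i: "i \<in> {1..<d}"
  shows "acts (H i * a) (\<lambda>T. gop i (P T))"
proof -
  obtain c where c: "\<And>g. g \<in> Sym d \<Longrightarrow> tsupp d (c g)" "a = pbw c"
      "\<And>T. hsupp d T \<Longrightarrow> hsupp d (P T) \<and> heq scM d (P T) (lift_act c T)"
    using assms unfolding acts_def by blast
  let ?s = "\<lambda>g. slot i sigma (c g)" and ?r = "\<lambda>g. slot i rho (c g)"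
  have "H i * a = (\<Sum>g\<in>Sym d. (H i * iota (c g)) * gw d H g)"
    by (simp add: c(2) pbw_def sum_distrib_left mult.assoc)
  also have "\<dots> = (\<Sum>g\<in>Sym d. iota (?s g) * (H i * gw d H g) + iota (?r g) * gw d H g)"
    using H_comm_B i c(1) by (simp add: distrib_right mult.assoc)
  finally have mult: "H i * a = \<dots>" .
  have "acts (H i * a)
      (\<lambda>T. \<Sum>g\<in>Sym d. bop (?s g) (gop i (perm_op g T)) + bop (?r g) (perm_op g T))"
    unfolding mult
    by (intro acts_sum acts_add acts_iota_mult acts_gen_gw acts_gw tsupp_sigma tsupp_rho i c)
  then show ?thesis
  proof (rule acts_cong)
    fix T :: "('m, 'k) mh" assume T: "hsupp d T"
    show "hsupp d (gop i (P T))" using c(3) T i by (simp add: hsupp_gop)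
    have "heq scM d (gop i (P T)) (gop i (lift_act c T))"
      using c T by (intro heq_gop i hsupp_lift_act) auto
    also have "heq scM d (gop i (lift_act c T))
       (\<Sum>g\<in>Sym d. bop (?s g) (gop i (perm_op g T)) + bop (?r g) (perm_op g T))"
      unfolding lift_act_def gop_sum
      by (intro heq_sum gop_bop_heq i c hsupp_perm_op T)
    finally show "heq scM d (gop i (P T)) \<dots>" .
  qed
qed

lemma acts_gen_prod_mult:
  "set ws \<subseteq> {1..<d} \<Longrightarrow> acts a P \<Longrightarrow> acts (gen_prod H ws * a) (\<lambda>T. gopw ws (P T))"
  by (induction ws) (simp_all add: mult.assoc acts_gen_mult)

lemma acts_one: "acts 1 (\<lambda>T. T)"
  using acts_cong[OF acts_gw[OF id_Sym], of "\<lambda>T. T"]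
    gopw_reduced[OF _ reduced_expr_rexp[OF id_Sym], of "[]"]
  by (simp add: perm_op_def)

lemma choice_map_reduced: "choice_map d r \<Longrightarrow> w \<in> Sym d \<Longrightarrow> reduced_expr d (r w) w"
  by (simp add: choice_map_def)

text \<open>The side of both axioms that is written with coordinates. \<open>perm_op\<close> follows
  \<open>rexp\<close> while \<tau> follows \<open>r\<close>; both words are reduced, so the
  operators agree.\<close>

lemma lift_act_tau:
  assumes r: "choice_map d r" and c: "\<And>g. g \<in> Sym d \<Longrightarrow> tsupp d (c g)" and m: "tsupp d m"
  shows "heq scM d (lift_act c (hpure m)) (\<lambda>z. \<Sum>g\<in>Sym d. tac (c g) (tau_word sH h d sM rM (r g) m z))"
proof -
  have "heq scM d (lift_act c (hpure m)) (\<Sum>g\<in>Sym d. bop (c g) (gopw (r g) (hpure m)))"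
    unfolding lift_act_def perm_op_def
    using r m choice_map_reduced[OF r] reduced_expr_rexp
    by (intro heq_sum heq_bop c gopw_reduced hsupp_gopw hsupp_hpure)
      (auto simp: reduced_expr_def)
  also have "heq scM d \<dots> (\<lambda>z. \<Sum>g\<in>Sym d. tac (c g) (tau_word sH h d sM rM (r g) m z))"
    by (rule heq_agree) (simp add: sum_fun_apply bop_apply tau_word_eq)
  finally show ?thesis .
qed

lemma tau_choice_independent:
  assumes r: "choice_map d r" and r': "choice_map d r'" and w: "w \<in> Sym d" and m: "tsupp d m"
  shows "heq scM d (tau_word sH h d sM rM (r w) m) (tau_word sH h d sM rM (r' w) m)"
  using gopw_reduced[OF choice_map_reduced[OF r w] choice_map_reduced[OF r' w] hsupp_hpure[OF m]]
  by (simp add: heq_def tau_word_eq)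

text \<open>H_w b acts in two ways, as the operators of a reduced word of w after that of b and
  through its coordinates \<open>c\<close>. Uniqueness compares them at m \<otimes> 1, where b (m
  \<otimes> 1) = (b m) \<otimes> 1.\<close>

lemma tau_mult_B:
  assumes r: "choice_map d r" and w: "w \<in> Sym d" and b: "tsupp d b" and m: "tsupp d m"
    and c: "\<forall>g\<in>Sym d. tsupp d (c g)"
    and eq: "gw d H w * iota b = (\<Sum>g\<in>Sym d. iota (c g) * gw d H g)"
  shows "heq scM d (tau_word sH h d sM rM (r w) (tac b m))
      (\<lambda>z. \<Sum>g\<in>Sym d. tac (c g) (tau_word sH h d sM rM (r g) m z))"
proof -
  note red = choice_map_reduced[OF r w]
  have "acts (gw d H w * iota b) (\<lambda>T. gopw (r w) (bop b T))"
    using acts_gen_prod_mult[OF _ acts_iota_mult[OF acts_one b], of "r w"] red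
    by (simp add: H.gw_reduced[OF red] reduced_expr_def)
  from acts_unique[OF this _ eq[folded pbw_def] hsupp_hpure[OF m]] c
  have "heq scM d (gopw (r w) (bop b (hpure m))) (lift_act c (hpure m))" by simp
  also note lift_act_tau[OF r _ m, of c]
  finally have *: "heq scM d (gopw (r w) (bop b (hpure m)))
      (\<lambda>z. \<Sum>g\<in>Sym d. tac (c g) (tau_word sH h d sM rM (r g) m z))" using c by simp
  have "gopw (r w) (bop b (hpure m)) z = tau_word sH h d sM rM (r w) (tac b m) z" if "z \<in> Sym d" for z
    unfolding tau_word_eq[OF that]
    by (rule gopw_agree[OF _ that]) (simp add: bop_apply hpure_def plinear_zero[OF plinear_tact])
  with * show ?thesis
    by (simp add: heq_def)
qed

lemma tau_mult_H:
  assumes r: "choice_map d r" and w: "w \<in> Sym d" and x: "x \<in> Sym d" and m: "tsupp d m"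
    and c: "\<forall>g\<in>Sym d. tsupp d (c g)"
    and eq: "gw d H w * gw d H x = (\<Sum>g\<in>Sym d. iota (c g) * gw d H g)"
  shows "heq scM d (\<lambda>z. \<Sum>g\<in>Sym d. tac (c g) (tau_word sH h d sM rM (r g) m z))
     (\<lambda>z. \<Sum>y\<in>Sym d. hright sH h d (tau_word sH h d sM rM (r w) (tau_word sH h d sM rM (r x) m y)) (gw d h y) z)"
proof -
  note red = choice_map_reduced[OF r w] and red' = choice_map_reduced[OF r x]
  have "acts (gw d H w * gw d H x) (\<lambda>T. gopw (r w) (gopw (r x) T))"
    using acts_gen_prod_mult[OF _ acts_gen_prod_mult[OF _ acts_one], of "r w" "r x"] red red'
    by (simp add: H.gw_reduced[OF red] H.gw_reduced[OF red'] reduced_expr_def)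
  from acts_unique[OF this _ eq[folded pbw_def] hsupp_hpure[OF m]] c
  have 1: "heq scM d (gopw (r w) (gopw (r x) (hpure m))) (lift_act c (hpure m))" by simp
  have 2: "heq scM d (\<lambda>z. \<Sum>g\<in>Sym d. tac (c g) (tau_word sH h d sM rM (r g) m z))
      (gopw (r w) (gopw (r x) (hpure m)))"
    using heq_trans[OF 1 lift_act_tau[OF r _ m, of c]] c by (simp add: heq_sym)
  then show ?thesis
    by (simp add: heq_def tau_compose)
qed

theorem relations_imp_ground: "ground_module act sB H iota sH h d sM rM"
  unfolding ground_module_def Let_def
  using tau_choice_independent tau_mult_B tau_mult_H by blast

end

subsection \<open>The ground module axioms imply the relations\<close>

text \<open>Makes the six coefficients in the expanded braid relation independent. The images of i,
  i + 1, i + 2 already tell the elements apart.\<close>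

lemma distinct_braid_elements:
  "distinct [id, sref i, sref (Suc i), sref i \<circ> sref (Suc i), sref (Suc i) \<circ> sref i,
     sref i \<circ> (sref (Suc i) \<circ> sref i)]"
proof -
  let ?f = "\<lambda>w. (w i, w (Suc i), w (Suc (Suc i)) :: nat)"
  have "distinct (map ?f [id, sref i, sref (Suc i), sref i \<circ> sref (Suc i), sref (Suc i) \<circ> sref i,
     sref i \<circ> (sref (Suc i) \<circ> sref i)])"
    by (simp add: sref_apply)
  then show ?thesis unfolding distinct_map by blast
qed

lemma hpure_apply: "hpure m z = (if z = id then m else 0)"
  by (simp add: hpure_def)

context wreath_module
begin

lemma coord_gen: "i \<in> {1..<d} \<Longrightarrow> coord (h i) z = of_bool (z = sref i)"
  using coord_gw[OF sref_Sym] by simp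

lemma gop_hpure:
  "gop i (hpure m) z = pscale (coord (h i) z) (sl i m) + pscale (coord 1 z) (rl i m)"
  by (simp add: gop_def tens_hpure plinear_slot)

lemma sref_neq_id: "sref i \<noteq> id"
  by (metis id_apply n_not_Suc_n sref_apply)

text \<open>The conclusions are the coefficients at s_i s_j s_i, s_i s_j, s_j s_i, s_i, s_j and 1,
  in this order, where j = i + 1. Both sides expand over these same elements because the two longest
  products in the Hecke algebra coincide.\<close>

lemma braid_coefficients:
  assumes i: "i \<in> {1..<d}" and j: "Suc i \<in> {1..<d}"
    and eq: "heq scM d (gop i (gop (Suc i) (gop i (hpure m)))) (gop (Suc i) (gop i (gop (Suc i) (hpure m))))"
  shows "teq scM (sl i (sl (Suc i) (sl i m))) (sl (Suc i) (sl i (sl (Suc i) m)))"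
    and "teq scM (sl i (sl (Suc i) (rl i m))) (rl (Suc i) (sl i (sl (Suc i) m)))"
    and "teq scM (rl i (sl (Suc i) (sl i m))) (sl (Suc i) (sl i (rl (Suc i) m)))"
    and "teq scM (pscale chiS (sl i (rl (Suc i) (sl i m))) + rl i (rl (Suc i) (sl i m)) + sl i (rl (Suc i) (rl i m)))
      (rl (Suc i) (sl i (rl (Suc i) m)))"
    and "teq scM (rl i (sl (Suc i) (rl i m)))
      (pscale chiS (sl (Suc i) (rl i (sl (Suc i) m))) + rl (Suc i) (rl i (sl (Suc i) m)) + sl (Suc i) (rl i (rl (Suc i) m)))"
    and "teq scM (rl i (rl (Suc i) (rl i m)) + pscale chiR (sl i (rl (Suc i) (sl i m))))
      (rl (Suc i) (rl i (rl (Suc i) m)) + pscale chiR (sl (Suc i) (rl i (sl (Suc i) m))))"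
proof -
  let ?j = "Suc i"
  have si: "sref i \<in> Sym d" and sj: "sref ?j \<in> Sym d" using sref_Sym i j by blast+
  have mem: "sref i \<circ> sref ?j \<in> Sym d" "sref ?j \<circ> sref i \<in> Sym d" "sref i \<circ> (sref ?j \<circ> sref i) \<in> Sym d"
    by (intro sref_comp_Sym i j si sj)+
  have inv: "inv (sref k) = sref k" for k
    by (rule inv_unique_comp) (auto simp: fun_eq_iff)
  have gij: "gw d h (sref i \<circ> sref ?j) = h i * h ?j" "gw d h (sref ?j \<circ> sref i) = h ?j * h i"
    using gw_up[OF sj i] gw_up[OF si j] i j by (simp_all add: inv sref_apply)
  have "gw d h (sref i \<circ> (sref ?j \<circ> sref i)) = h i * gw d h (sref ?j \<circ> sref i)"
    by (rule gw_up[OF mem(2) i]) (simp add: inv_sref_comp[OF si] inv sref_apply)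
  then have giji: "gw d h (sref i \<circ> (sref ?j \<circ> sref i)) = h i * (h ?j * h i)" by (simp only: gij)
  have hb: "h ?j * (h i * h ?j) = h i * (h ?j * h i)"
    using braid_rel[rule_format, of i] i j by (simp add: mult.assoc)
  note coords = coord_gen[OF i] coord_gen[OF j] coord_one coord_gw[OF mem(1), unfolded gij]
    coord_gw[OF mem(2), unfolded gij] coord_gw[OF mem(3), unfolded giji]
  have pl: "plinear (sl k)" "plinear (rl k)" for k by (rule plinear_slot)+
  have pl3: "plinear (\<lambda>v. F (G (K v)))" if "plinear F" "plinear G" "plinear K"
    for F G K :: "('m list \<Rightarrow>\<^sub>0 'k) \<Rightarrow> ('m list \<Rightarrow>\<^sub>0 'k)" using that by (simp add: plinear_def)
  have exp: "gop a (gop b (gop a (hpure m))) z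
    = pscale (coord (h a * (h b * h a)) z) (sl a (sl b (sl a m)))
    + pscale (coord (h a * h b) z) (sl a (sl b (rl a m)))
    + pscale (coord (h b * h a) z) (rl a (sl b (sl a m)))
    + pscale (coord (h a) z) (pscale chiS (sl a (rl b (sl a m))) + rl a (rl b (sl a m)) + sl a (rl b (rl a m)))
    + pscale (coord (h b) z) (rl a (sl b (rl a m)))
    + pscale (coord 1 z) (rl a (rl b (rl a m)) + pscale chiR (sl a (rl b (sl a m))))"
    if a: "a \<in> {1..<d}" for a b z
    unfolding gop_gop_gop[OF a] plus_fun_apply
    by (simp only: tens_hpure pl3 pl plinear_plus plinear_scaled)
  note at = eq[unfolded heq_def exp[OF i] exp[OF j] hb coords, rule_format]
  \<comment> \<open>Feeds the pairwise distinctness to the simplifier, so that evaluation at one of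
    the six elements leaves a single term on each side.\<close>
  have ne: "x \<noteq> y \<Longrightarrow> of_bool (x = y) = (0 :: 'k)" for x y :: "nat \<Rightarrow> nat" by simp
  note eval = distinct.simps list.set insert_iff de_Morgan_disj empty_iff not_False_eq_True simp_thms
    of_bool_eq pscale_zero_left pscale_one add_0_left add_0_right ne[OF not_sym]
  show "teq scM (sl i (sl ?j (sl i m))) (sl ?j (sl i (sl ?j m)))"
    using at[OF mem(3)] distinct_braid_elements[of i]
    by (simp only: eval)
  show "teq scM (sl i (sl ?j (rl i m))) (rl ?j (sl i (sl ?j m)))"
    using at[OF mem(1)] distinct_braid_elements[of i]
    by (simp only: eval)
  show "teq scM (rl i (sl ?j (sl i m))) (sl ?j (sl i (rl ?j m)))"
    using at[OF mem(2)] distinct_braid_elements[of i]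
    by (simp only: eval)
  show "teq scM (pscale chiS (sl i (rl ?j (sl i m))) + rl i (rl ?j (sl i m)) + sl i (rl ?j (rl i m)))
      (rl ?j (sl i (rl ?j m)))"
    using at[OF si] distinct_braid_elements[of i]
    by (simp only: eval)
  show "teq scM (rl i (sl ?j (rl i m)))
      (pscale chiS (sl ?j (rl i (sl ?j m))) + rl ?j (rl i (sl ?j m)) + sl ?j (rl i (rl ?j m)))"
    using at[OF sj] distinct_braid_elements[of i]
    by (simp only: eval)
  show "teq scM (rl i (rl ?j (rl i m)) + pscale chiR (sl i (rl ?j (sl i m))))
      (rl ?j (rl i (rl ?j m)) + pscale chiR (sl ?j (rl i (sl ?j m))))"
    using at[OF id_Sym] distinct_braid_elements[of i]
    by (simp only: eval)
qed

text \<open>The PBW expansions of both H_i b and H_i^2 are supported on s_i and 1.\<close>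

lemma sum_sref_id:
  fixes F :: "(nat \<Rightarrow> nat) \<Rightarrow> 'z::comm_monoid_add"
  assumes "i \<in> {1..<d}" "\<And>g. g \<noteq> sref i \<Longrightarrow> g \<noteq> id \<Longrightarrow> F g = 0"
  shows "(\<Sum>g\<in>Sym d. F g) = F (sref i) + F id"
proof -
  have "(\<Sum>g\<in>Sym d. F g) = (\<Sum>g\<in>{sref i, id}. F g)"
    using assms sref_Sym by (intro sum.mono_neutral_right) auto
  then show ?thesis using sref_neq_id by simp
qed

context
  assumes ground: "ground_module act sB H iota sH h d sM rM"
begin

definition cmap :: "(nat \<Rightarrow> nat) \<Rightarrow> nat list" where
  "cmap = (SOME r. choice_map d r)"

lemma choice_map_cmap: "choice_map d cmap"
  unfolding cmap_def by (rule someI_ex[OF exists_choice_map])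

lemma cmap_simps: "cmap id = []" "i \<in> {1..<d} \<Longrightarrow> cmap (sref i) = [i]"
  using choice_map_cmap choice_map_sref by (auto simp: choice_map_def)

lemma ground_B:
  assumes "w \<in> Sym d" "tsupp d b" "tsupp d m" "\<And>g. g \<in> Sym d \<Longrightarrow> tsupp d (c g)"
    and "gw d H w * iota b = (\<Sum>g\<in>Sym d. iota (c g) * gw d H g)"
    and z: "z \<in> Sym d"
  shows "teq scM (gopw (cmap w) (hpure (tac b m)) z) (\<Sum>g\<in>Sym d. tac (c g) (gopw (cmap g) (hpure m) z))"
proof -
  have "heq scM d (tau_word sH h d sM rM (cmap w) (tac b m))
      (\<lambda>z. \<Sum>g\<in>Sym d. tac (c g) (tau_word sH h d sM rM (cmap g) m z))"
    using ground assms choice_map_cmap unfolding ground_module_def Let_def by blast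
  then show ?thesis using z by (simp add: heq_def tau_word_eq)
qed

lemma ground_H:
  assumes "w \<in> Sym d" "x \<in> Sym d" "tsupp d m" "\<And>g. g \<in> Sym d \<Longrightarrow> tsupp d (c g)"
    and "gw d H w * gw d H x = (\<Sum>g\<in>Sym d. iota (c g) * gw d H g)"
    and z: "z \<in> Sym d"
  shows "teq scM (\<Sum>g\<in>Sym d. tac (c g) (gopw (cmap g) (hpure m) z)) (gopw (cmap w) (gopw (cmap x) (hpure m)) z)"
proof -
  have "heq scM d (\<lambda>z. \<Sum>g\<in>Sym d. tac (c g) (tau_word sH h d sM rM (cmap g) m z))
     (\<lambda>z. \<Sum>y\<in>Sym d. hright sH h d (tau_word sH h d sM rM (cmap w) (tau_word sH h d sM rM (cmap x) m y)) (gw d h y) z)"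
    using ground assms choice_map_cmap unfolding ground_module_def Let_def by blast
  from this[unfolded heq_def, rule_format, OF z]
  have "teq scM (\<Sum>g\<in>Sym d. tac (c g) (tau_word sH h d sM rM (cmap g) m z))
      (gopw (cmap w) (gopw (cmap x) (hpure m)) z)"
    unfolding tau_compose[OF z] .
  then show ?thesis using z by (simp only: tau_word_eq)
qed

lemma ground_M2:
  assumes i: "i \<in> {1..<d}" and b: "tsupp d b" and m: "tsupp d m"
  shows "teq scM (sl i (tac b m)) (tac (slot i sigma b) (sl i m))"
    and "teq scM (rl i (tac b m)) (tac (slot i sigma b) (rl i m) + tac (slot i rho b) m)"
proof -
  \<comment> \<open>PBW coordinates of H_i b; the two equations of (M2) are then the coefficients of
    the axiom at h_i and at 1.\<close>
  let ?c = "\<lambda>g. if g = sref i then slot i sigma b else if g = id then slot i rho b else 0"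
  have at: "teq scM (gop i (hpure (tac b m)) z)
      (tac (slot i sigma b) (gop i (hpure m) z) + tac (slot i rho b) (hpure m z))" if "z \<in> Sym d" for z
  proof -
    have "teq scM (gopw (cmap (sref i)) (hpure (tac b m)) z)
        (\<Sum>g\<in>Sym d. tac (?c g) (gopw (cmap g) (hpure m) z))"
      by (intro ground_B sref_Sym i b m that)
        (use H_comm_B i b sref_neq_id[of i] in
          \<open>auto simp: tsupp_sigma tsupp_rho sum_sref_id[OF i] iota_zero H.gw_sref[OF i]\<close>)
    then show ?thesis
      using sref_neq_id[of i]
      by (simp add: sum_sref_id[OF i] plinear_zero[OF plinear_tact_left] cmap_simps(1) cmap_simps(2)[OF i])
  qed
  show "teq scM (sl i (tac b m)) (tac (slot i sigma b) (sl i m))"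
    using at[OF sref_Sym[OF i]] sref_neq_id[of i]
    by (simp add: gop_hpure coord_gen[OF i] coord_one hpure_apply plinear_zero[OF plinear_tact])
  show "teq scM (rl i (tac b m)) (tac (slot i sigma b) (rl i m) + tac (slot i rho b) m)"
    using at[OF id_Sym] sref_neq_id[of i]
    by (simp add: gop_hpure coord_gen[OF i] coord_one hpure_apply)
qed

lemma ground_M4:
  assumes i: "i \<in> {1..<d}" and m: "tsupp d m"
  shows "teq scM (pscale chiS (sl i (sl i m)) + rl i (sl i m) + sl i (rl i m)) (tac (emb d i S) (sl i m))"
    and "teq scM (pscale chiR (sl i (sl i m)) + rl i (rl i m)) (tac (emb d i S) (rl i m) + tac (emb d i R) m)"
proof -
  \<comment> \<open>PBW coordinates of H_i^2, read from the quadratic relation.\<close>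
  let ?c = "\<lambda>g. if g = sref i then emb d i S else if g = id then emb d i R else 0"
  have at: "teq scM (gop i (gop i (hpure m)) z)
      (tac (emb d i S) (gop i (hpure m) z) + tac (emb d i R) (hpure m z))" if "z \<in> Sym d" for z
  proof -
    have "teq scM (\<Sum>g\<in>Sym d. tac (?c g) (gopw (cmap g) (hpure m) z))
        (gopw (cmap (sref i)) (gopw (cmap (sref i)) (hpure m)) z)"
      by (intro ground_H sref_Sym i m that)
        (use H_quad i sref_neq_id[of i] in
          \<open>auto simp: tsupp_embS tsupp_embR sum_sref_id[OF i] iota_zero H.gw_sref[OF i]\<close>)
    then have "teq scM (tac (emb d i S) (gop i (hpure m) z) + tac (emb d i R) (hpure m z))
        (gop i (gop i (hpure m)) z)"
      using sref_neq_id[of i]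
      by (simp add: sum_sref_id[OF i] plinear_zero[OF plinear_tact_left] cmap_simps(1) cmap_simps(2)[OF i])
    then show ?thesis by (rule teq_sym)
  qed
  have exp: "gop i (gop i (hpure m)) z
     = pscale (coord (h i) z) (pscale chiS (sl i (sl i m)) + rl i (sl i m) + sl i (rl i m))
     + pscale (coord 1 z) (pscale chiR (sl i (sl i m)) + rl i (rl i m))" for z
    unfolding gop_gop_same[OF i] plus_fun_apply
    by (simp only: tens_hpure plinear_plus plinear_scaled plinear_slot plinear_comp[OF plinear_slot plinear_slot])
  show "teq scM (pscale chiS (sl i (sl i m)) + rl i (sl i m) + sl i (rl i m)) (tac (emb d i S) (sl i m))"
    using at[OF sref_Sym[OF i]] sref_neq_id[of i] unfolding exp
    by (simp add: gop_hpure coord_gen[OF i] coord_one hpure_apply plinear_zero[OF plinear_tact])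
  show "teq scM (pscale chiR (sl i (sl i m)) + rl i (rl i m)) (tac (emb d i S) (rl i m) + tac (emb d i R) m)"
    using at[OF id_Sym] sref_neq_id[of i] unfolding exp
    by (simp add: gop_hpure coord_gen[OF i] coord_one hpure_apply)
qed

lemma hsupp_cmap: "w \<in> Sym d \<Longrightarrow> tsupp d m \<Longrightarrow> hsupp d (gopw (cmap w) (hpure m))"
  using choice_map_cmap by (intro hsupp_gopw hsupp_hpure) (auto simp: choice_map_def reduced_expr_def)

text \<open>At an ascent H_i H_w = H_{s_i w} has the unit as its only coordinate, so the axiom gives
  the recursion of \<tau> for every ascent, not merely for the first letter that \<open>cmap\<close>
  happens to choose.\<close>

lemma ground_up:
  assumes w: "w \<in> Sym d" and i: "i \<in> {1..<d}" and up: "inv w i < inv w (Suc i)" and m: "tsupp d m"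
  shows "heq scM d (gopw (cmap (sref i \<circ> w)) (hpure m)) (gop i (gopw (cmap w) (hpure m)))"
proof -
  let ?w = "sref i \<circ> w"
  let ?c = "\<lambda>g. if g = ?w then tone d else 0"
  note w' = sref_comp_Sym[OF i w]
  have sum1: "(\<Sum>g\<in>Sym d. F g) = F ?w" if "\<And>g. g \<noteq> ?w \<Longrightarrow> F g = 0" for F :: "_ \<Rightarrow> 'z::comm_monoid_add"
    using that w' by (subst sum.mono_neutral_right[of "Sym d" "{?w}"]) auto
  have "teq scM (gopw (cmap ?w) (hpure m) z) (gop i (gopw (cmap w) (hpure m)) z)" if z: "z \<in> Sym d" for z
  proof -
    have "gw d H (sref i) * gw d H w = (\<Sum>g\<in>Sym d. iota (?c g) * gw d H g)"
      by (subst sum1) (simp_all add: iota_zero iota_one H.gw_up[OF w i up] H.gw_sref[OF i])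
    then have "teq scM (\<Sum>g\<in>Sym d. tac (?c g) (gopw (cmap g) (hpure m) z))
        (gopw (cmap (sref i)) (gopw (cmap w) (hpure m)) z)"
      using i w m z by (intro ground_H sref_Sym) auto
    moreover have "(\<Sum>g\<in>Sym d. tac (?c g) (gopw (cmap g) (hpure m) z)) = gopw (cmap ?w) (hpure m) z"
      using hsupp_cmap[OF w' m] z
      by (subst sum1) (auto simp: plinear_zero[OF plinear_tact_left] hsupp_def intro!: tact_tone act_simps)
    ultimately show ?thesis by (simp add: cmap_simps(1) cmap_simps(2)[OF i])
  qed
  then show ?thesis by (simp add: heq_def)
qed

text \<open>\<open>cmap\<close> selects one of the two reduced words of s_i s_j s_i, where j = i +
  1. By \<open>ground_up\<close> the operators along either word compute \<tau> of this one
  permutation, hence agree at m \<otimes> 1.\<close>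

lemma ground_braid:
  assumes i: "i \<in> {1..<d}" and j: "Suc i \<in> {1..<d}" and m: "tsupp d m"
  shows "heq scM d (gop i (gop (Suc i) (gop i (hpure m)))) (gop (Suc i) (gop i (gop (Suc i) (hpure m))))"
proof -
  have inv: "inv (sref k) = sref k" for k
    by (rule inv_unique_comp) (auto simp: fun_eq_iff)
  have *: "heq scM d (gopw (cmap (sref a \<circ> (sref b \<circ> sref a))) (hpure m)) (gop a (gop b (gop a (hpure m))))"
    if a: "a \<in> {1..<d}" and b: "b \<in> {1..<d}" and ab: "b = Suc a \<or> a = Suc b" for a b
  proof -
    note sa = sref_Sym[OF a]
    note sba = sref_comp_Sym[OF b sa]
    have up1: "inv (sref a) b < inv (sref a) (Suc b)"
      using ab by (auto simp: inv sref_apply)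
    have up2: "inv (sref b \<circ> sref a) a < inv (sref b \<circ> sref a) (Suc a)"
      using ab by (auto simp: inv_sref_comp[OF sa] inv sref_apply)
    have "heq scM d (gopw (cmap (sref a \<circ> (sref b \<circ> sref a))) (hpure m)) (gop a (gopw (cmap (sref b \<circ> sref a)) (hpure m)))"
      by (rule ground_up[OF sba a up2 m])
    also have "heq scM d \<dots> (gop a (gop b (gopw (cmap (sref a)) (hpure m))))"
      by (intro heq_gop a hsupp_cmap sba hsupp_gop b sa m ground_up up1)
    finally show ?thesis by (simp add: cmap_simps(2)[OF a])
  qed
  have eq: "sref i \<circ> (sref (Suc i) \<circ> sref i) = sref (Suc i) \<circ> (sref i \<circ> sref (Suc i))"
    using sref_braid[of i id] by simp
  have "heq scM d (gopw (cmap (sref i \<circ> (sref (Suc i) \<circ> sref i))) (hpure m))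
      (gop (Suc i) (gop i (gop (Suc i) (hpure m))))"
    unfolding eq by (rule *[OF j i]) simp
  from heq_trans[OF heq_sym[OF *[OF i j]] this] show ?thesis by simp
qed

text \<open>For j = i + 1 these are four of the six coefficients. For i = j + 1 they are the
  coefficients of the pair starting at \<open>j\<close> read backwards, among them the two left over
  in the other case.\<close>

lemma ground_adjacent:
  assumes i: "i \<in> {1..<d}" and j: "j \<in> {1..<d}" and ij: "j = i + 1 \<or> i = j + 1" and m: "tsupp d m"
  shows "teq scM (sl i (sl j (sl i m))) (sl j (sl i (sl j m)))"
    and "teq scM (rl i (sl j (sl i m))) (sl j (sl i (rl j m)))"
    and "teq scM (rl i (sl j (rl i m)))
      (pscale chiS (sl j (rl i (sl j m))) + rl j (rl i (sl j m)) + sl j (rl i (rl j m)))"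
    and "teq scM (rl i (rl j (rl i m)) + pscale chiR (sl i (rl j (sl i m))))
      (rl j (rl i (rl j m)) + pscale chiR (sl j (rl i (sl j m))))"
proof -
  note up = braid_coefficients[OF _ _ ground_braid[OF _ _ m]]
  from ij have "j = Suc i \<or> i = Suc j" by simp
  then show "teq scM (sl i (sl j (sl i m))) (sl j (sl i (sl j m)))"
    and "teq scM (rl i (sl j (sl i m))) (sl j (sl i (rl j m)))"
    and "teq scM (rl i (sl j (rl i m)))
      (pscale chiS (sl j (rl i (sl j m))) + rl j (rl i (sl j m)) + sl j (rl i (rl j m)))"
    and "teq scM (rl i (rl j (rl i m)) + pscale chiR (sl i (rl j (sl i m))))
      (rl j (rl i (rl j m)) + pscale chiR (sl j (rl i (sl j m))))"
    using up(1,3,5,6)[of i] teq_sym[OF up(1)[of j]] teq_sym[OF up(2)[of j]] teq_sym[OF up(4)[of j]]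
      teq_sym[OF up(6)[of j]] i j by (elim disjE; simp)+
qed

end

end

theorem theorem4p5:
  fixes sB :: "'k::comm_ring_1 \<Rightarrow> 'b::ring_1 \<Rightarrow> 'b"
    and act :: "'b \<Rightarrow> 'm::ab_group_add \<Rightarrow> 'm"
    and d :: nat
    and S R :: "'b list \<Rightarrow>\<^sub>0 'k"
    and sigma rho :: "('b list \<Rightarrow>\<^sub>0 'k) \<Rightarrow> ('b list \<Rightarrow>\<^sub>0 'k)"
    and H :: "nat \<Rightarrow> 'a::ring_1"
    and iota :: "('b list \<Rightarrow>\<^sub>0 'k) \<Rightarrow> 'a"
    and sH :: "'k \<Rightarrow> 'h::ring_1 \<Rightarrow> 'h"
    and h :: "nat \<Rightarrow> 'h"
    and chiS chiR :: 'k
    and sM rM :: "('m list \<Rightarrow>\<^sub>0 'k) \<Rightarrow> ('m list \<Rightarrow>\<^sub>0 'k)"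
  defines "scM \<equiv> (\<lambda>c m. act (sB c 1) m)"
  assumes d2: "2 \<le> d"
    \<comment> \<open>B is a unital associative K-algebra, free as a K-module\<close>
    and B_mod: "module sB"
    and B_alg: "\<forall>c x y. sB c (x * y) = sB c x * y \<and> sB c (x * y) = x * sB c y"
    and B_free: "\<exists>X. \<not> module.dependent sB X \<and> module.span sB X = UNIV"
    \<comment> \<open>M is a left B-module (with K acting through K -> B)\<close>
    and M_mod: "\<forall>a b m n. act 1 m = m \<and> act (a * b) m = act a (act b m)
                  \<and> act (a + b) m = act a m + act b m \<and> act a (m + n) = act a m + act a n"
    \<comment> \<open>S, R in B (x) B; sigma, rho K-linear endomorphisms of B (x) B\<close>
    and S2: "tsupp 2 S" and R2: "tsupp 2 R"
    and sigma_lin: "tlin sB 2 sigma" and rho_lin: "tlin sB 2 rho"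
    \<comment> \<open>the quantum wreath product B wr H(d) with its PBW basis\<close>
    and iota_wd: "\<forall>v w. tsupp d v \<longrightarrow> tsupp d w \<longrightarrow> teq sB v w \<longrightarrow> iota v = iota w"
    and iota_add: "\<forall>v w. tsupp d v \<longrightarrow> tsupp d w \<longrightarrow> iota (v + w) = iota v + iota w"
    and iota_mult: "\<forall>v w. tsupp d v \<longrightarrow> tsupp d w \<longrightarrow> iota (tact (*) v w) = iota v * iota w"
    and iota_one: "iota (tone d) = 1"
    and H_braid: "\<forall>k. 1 \<le> k \<and> k + 1 < d \<longrightarrow> H k * H (k + 1) * H k = H (k + 1) * H k * H (k + 1)"
    and H_comm: "\<forall>i j. i \<in> {1..<d} \<and> j \<in> {1..<d} \<and> (i + 2 \<le> j \<or> j + 2 \<le> i) \<longrightarrow> H i * H j = H j * H i"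
    and H_quad: "\<forall>i\<in>{1..<d}. H i * H i = iota (emb d i S) * H i + iota (emb d i R)"
    and H_comm_B: "\<forall>i\<in>{1..<d}. \<forall>b. tsupp d b \<longrightarrow>
                     H i * iota b = iota (slot i sigma b) * H i + iota (slot i rho b)"
    and PBW_span: "\<forall>x::'a. \<exists>c. (\<forall>w\<in>Sym d. tsupp d (c w)) \<and> x = (\<Sum>w\<in>Sym d. iota (c w) * gw d H w)"
    and PBW_indep: "\<forall>c c'. (\<forall>w\<in>Sym d. tsupp d (c w) \<and> tsupp d (c' w)) \<longrightarrow>
                     (\<Sum>w\<in>Sym d. iota (c w) * gw d H w) = (\<Sum>w\<in>Sym d. iota (c' w) * gw d H w) \<longrightarrow>
                     (\<forall>w\<in>Sym d. teq sB (c w) (c' w))"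
    \<comment> \<open>the twisted Hecke algebra with K-basis (h_w)\<close>
    and Hk_mod: "module sH"
    and Hk_alg: "\<forall>c x y. sH c (x * y) = sH c x * y \<and> sH c (x * y) = x * sH c y"
    and h_braid: "\<forall>k. 1 \<le> k \<and> k + 1 < d \<longrightarrow> h k * h (k + 1) * h k = h (k + 1) * h k * h (k + 1)"
    and h_comm: "\<forall>i j. i \<in> {1..<d} \<and> j \<in> {1..<d} \<and> (i + 2 \<le> j \<or> j + 2 \<le> i) \<longrightarrow> h i * h j = h j * h i"
    and h_quad: "\<forall>i\<in>{1..<d}. h i * h i = sH chiS (h i) + sH chiR 1"
    and h_span: "\<forall>x::'h. \<exists>c. x = (\<Sum>w\<in>Sym d. sH (c w) (gw d h w))"
    and h_indep: "\<forall>c. (\<Sum>w\<in>Sym d. sH (c w) (gw d h w)) = 0 \<longrightarrow> (\<forall>w\<in>Sym d. c w = 0)"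
    \<comment> \<open>the module M: S, R act on M (x) M by chi(S), chi(R); sigma^M, rho^M in End_K(M (x) M)\<close>
    and S_act: "\<forall>u. tsupp 2 u \<longrightarrow> teq scM (tact act S u) (pscale chiS u)"
    and R_act: "\<forall>u. tsupp 2 u \<longrightarrow> teq scM (tact act R u) (pscale chiR u)"
    and sM_lin: "tlin scM 2 sM" and rM_lin: "tlin scM 2 rM"
  shows "ground_module act sB H iota sH h d sM rM \<longleftrightarrow>
    ((\<forall>i\<in>{1..<d}.
        \<comment> \<open>(M2)\<close>
        (\<forall>b m. tsupp d b \<longrightarrow> tsupp d m \<longrightarrow>
           teq scM (slot i sM (tact act b m)) (tact act (slot i sigma b) (slot i sM m)) \<and>
           teq scM (slot i rM (tact act b m))
                   (tact act (slot i sigma b) (slot i rM m) + tact act (slot i rho b) m)) \<and>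
        \<comment> \<open>(M4)\<close>
        (\<forall>m. tsupp d m \<longrightarrow>
           teq scM (pscale chiS (slot i sM (slot i sM m)) + slot i rM (slot i sM m) + slot i sM (slot i rM m))
                   (tact act (emb d i S) (slot i sM m)) \<and>
           teq scM (pscale chiR (slot i sM (slot i sM m)) + slot i rM (slot i rM m))
                   (tact act (emb d i S) (slot i rM m) + tact act (emb d i R) m)))
     \<and> (3 \<le> d \<longrightarrow>
        (\<forall>i\<in>{1..<d}. \<forall>j\<in>{1..<d}. (j = i + 1 \<or> i = j + 1) \<longrightarrow>
          (\<forall>m. tsupp d m \<longrightarrow>
             \<comment> \<open>(M5)\<close>
             teq scM (slot i sM (slot j sM (slot i sM m))) (slot j sM (slot i sM (slot j sM m))) \<and>
             teq scM (slot i rM (slot j sM (slot i sM m))) (slot j sM (slot i sM (slot j rM m))) \<and>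
             \<comment> \<open>(M6)\<close>
             teq scM (slot i rM (slot j sM (slot i rM m)))
                     (pscale chiS (slot j sM (slot i rM (slot j sM m)))
                      + slot j rM (slot i rM (slot j sM m)) + slot j sM (slot i rM (slot j rM m))) \<and>
             \<comment> \<open>(M7)\<close>
             teq scM (slot i rM (slot j rM (slot i rM m)) + pscale chiR (slot i sM (slot j rM (slot i sM m))))
                     (slot j rM (slot i rM (slot j rM m)) + pscale chiR (slot j sM (slot i rM (slot j sM m))))))))"
proof -
  interpret W: wreath_module d h sH chiS chiR H sB act S R sigma rho iota sM rM
    by (intro wreath_module.intro twisted_hecke.intro braided.intro twisted_hecke_axioms.intro
        wreath_module_axioms.intro)
      (fact h_braid h_comm Hk_mod Hk_alg h_quad h_span h_indep H_braid H_comm B_alg M_mod S2 R2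
        sigma_lin rho_lin iota_add iota_mult iota_one H_quad H_comm_B PBW_indep
        sM_lin[unfolded scM_def] rM_lin[unfolded scM_def])+
  show ?thesis (is "?ground \<longleftrightarrow> ?relations")
  proof
    assume g: ?ground
    show ?relations
      unfolding scM_def
      by (intro conjI ballI allI impI W.ground_M2[OF g] W.ground_M4[OF g] W.ground_adjacent[OF g]; assumption)
  next
    assume rel: ?relations
    \<comment> \<open>Two adjacent indices in \<open>{1..<d}\<close> force d \<ge> 3, which releases
      the premise of the second block of relations.\<close>
    have d3: "3 \<le> d" if "i \<in> {1..<d}" "j \<in> {1..<d}" "j = i + 1 \<or> i = j + 1" for i j
      using that by auto
    interpret ground_relations d h sH chiS chiR H sB act S R sigma rho iota sM rM
      by unfold_locales (use rel[unfolded scM_def] d3 in blast)+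
    show ?ground by (rule relations_imp_ground)
  qed
qed

end
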